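(* Let $T\ge 1$, $n\ge 2$, $d\ge 1$, $\boldsymbol\mu\in\mathbb{R}^d$, let $\boldsymbol\Sigma\in\mathbb{R}^{d\times d}$ be positive definite, let $\mathbf{z}^*\in\mathbb{R}^d$ and $\tau\in\{1,\dots,T\}$ be fixed. Data consist of $T$ batches $D_1,\dots,D_T$, batch $D_t$ consisting of $n$ points $\mathbf{X}_{t,1},\dots,\mathbf{X}_{t,n}\in\mathbb{R}^d$. Under the hypothesis $\mathbf{H_0}$ all $nT$ points are i.i.d. $\mathcal{N}(\boldsymbol\mu,\boldsymbol\Sigma)$. Under the hypothesis $\mathbf{H_1^\tau}$ the points are generated in the same way and then the $J$-th point of $D_\tau$ is replaced by $\mathbf{z}^*$, where $J$ is uniform on $\{1,\dots,n\}$ and independent of the data. The observations are the cumulative empirical means $\hat{\boldsymbol\mu}_t=\frac{1}{nt}\sum_{j=1}^t\sum_{k=1}^n\mathbf{X}_{j,k}$, $t=1,\dots,T$. Let $\bar{\mathbf{X}}_\tau=\frac1n\sum_{k=1}^n\mathbf{X}_{\tau,k}=\tau\hat{\boldsymbol\mu}_\tau-(\tau-1)\hat{\boldsymbol\mu}_{\tau-1}$ (with $\hat{\boldsymbol\mu}_0:=0$) and $\mathbf{N_\tau}=\bar{\mathbf{X}}_\tau-\boldsymbol\mu$. Then the logarithm $\log\mathrm{LR}_\tau$ of the ratio of the joint density of $(\hat{\boldsymbol\mu}_1,\dots,\hat{\boldsymbol\mu}_T)$ under $\mathbf{H_1^\tau}$ to its joint density under $\mathbf{H_0}$ satisfies \[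 \log\mathrm{LR}_\tau=-\frac d2\log\Big(\frac{n-1}{n}\Big)-\frac{n}{2(n-1)}\mathbf{N_\tau}^\top\boldsymbol\Sigma^{-1}\mathbf{N_\tau}+\frac{n}{n-1}\mathbf{N_\tau}^\top\boldsymbol\Sigma^{-1}(\mathbf{z}^*-\boldsymbol\mu)-\frac{m^*}{2(n-1)}, \] where $m^*=(\mathbf{z}^*-\boldsymbol\mu)^\top\boldsymbol\Sigma^{-1}(\mathbf{z}^*-\boldsymbol\mu)$.
   Context: This is the likelihood ratio for a membership inference test that observes the whole sequence of empirical means and knows the insertion time $\tau$ of the target $\mathbf{z}^*$. *)

theory Defs
  imports "HOL-Analysis.Analysis" "HOL-Probability.Probability"
begin

definition pos_def_mat :: "real^'d^'d \<Rightarrow> bool" where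
  "pos_def_mat S \<longleftrightarrow> transpose S = S \<and> (\<forall>x. x \<noteq> 0 \<longrightarrow> x \<bullet> (S *v x) > 0)"

definition gauss_density :: "real^'d \<Rightarrow> real^'d^'d \<Rightarrow> real^'d \<Rightarrow> real" where
  "gauss_density mu S x =
     exp (- ((x - mu) \<bullet> (matrix_inv S *v (x - mu))) / 2)
     / sqrt ((2 * pi) ^ CARD('d) * det S)"

definition gauss_measure :: "real^'d \<Rightarrow> real^'d^'d \<Rightarrow> (real^'d) measure" where
  "gauss_measure mu S = density lborel (\<lambda>x. ennreal (gauss_density mu S x))"

text \<open>Data: points X(t,k), t in 1..T (batch), k in 1..n (index within the batch).
  Under H0 all n*T points are i.i.d. N(mu, S).\<close>
definition H0_data :: "nat \<Rightarrow> nat \<Rightarrow> real^'d \<Rightarrow> real^'d^'d \<Rightarrow> (nat \<times> nat \<Rightarrow> real^'d) measure" where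
  "H0_data T n mu S = PiM ({1..T} \<times> {1..n}) (\<lambda>_. gauss_measure mu S)"

definition H1_data :: "nat \<Rightarrow> nat \<Rightarrow> nat \<Rightarrow> real^'d \<Rightarrow> real^'d^'d \<Rightarrow> real^'d
    \<Rightarrow> (nat \<times> nat \<Rightarrow> real^'d) measure" where
  "H1_data T n tau mu S z =
     measure_pmf (pmf_of_set {1..n}) \<bind>
       (\<lambda>J. distr (H0_data T n mu S) (H0_data T n mu S) (\<lambda>X. X((tau, J) := z)))"

definition obs_space :: "nat \<Rightarrow> (nat \<Rightarrow> real^'d) measure" where
  "obs_space T = PiM {1..T} (\<lambda>_. lborel)"

definition cum_means :: "nat \<Rightarrow> nat \<Rightarrow> (nat \<times> nat \<Rightarrow> real^'d) \<Rightarrow> (nat \<Rightarrow> real^'d)" where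
  "cum_means T n X = (\<lambda>t\<in>{1..T}. (1 / (real n * real t)) *\<^sub>R (\<Sum>j=1..t. \<Sum>k=1..n. X (j, k)))"

definition mu_hat :: "(nat \<Rightarrow> real^'d) \<Rightarrow> nat \<Rightarrow> real^'d" where
  "mu_hat y t = (if t = 0 then 0 else y t)"

text \<open>N_tau = bar X_tau - mu, where bar X_tau = tau hat mu_tau - (tau-1) hat mu_{tau-1}.\<close>
definition N_tau :: "nat \<Rightarrow> real^'d \<Rightarrow> (nat \<Rightarrow> real^'d) \<Rightarrow> real^'d" where
  "N_tau tau mu y = (real tau *\<^sub>R mu_hat y tau - (real tau - 1) *\<^sub>R mu_hat y (tau - 1)) - mu"

end

theory Submission
  imports Defs
begin

text \<open>
  Write \<open>W\<^sub>t\<close> for the mean of batch \<open>t\<close>. Under both hypotheses the \<open>W\<^sub>t\<close> are independent, and all of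
  them are \<open>N(\<mu>, \<Sigma>/n)\<close>, except that under the alternative \<open>W\<^sub>\<tau>\<close> is
  \<open>N((z + (n - 1) \<mu>)/n, (n - 1)/n\<^sup>2 \<Sigma>)\<close>, whatever the replaced index is. So the law of \<open>W\<close> under the
  alternative has a density \<open>r(W\<^sub>\<tau>)\<close> with respect to its law under the null hypothesis, where \<open>r\<close> is a
  ratio of two normal densities. The cumulative means are an injective function of \<open>W\<close> from which \<open>W\<^sub>\<tau>\<close>
  is recovered as \<open>\<tau> y\<^sub>\<tau> - (\<tau> - 1) y\<^sub>\<tau>\<^sub>-\<^sub>1\<close>, hence their laws have the density ratio
  \<open>r(\<tau> y\<^sub>\<tau> - (\<tau> - 1) y\<^sub>\<tau>\<^sub>-\<^sub>1)\<close>, and no Jacobian is needed. The change of variables enters only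
  up to null sets, to see that \<open>f0\<close> does not vanish on a set of positive measure.
\<close>

section \<open>Linear change of variables for Lebesgue measure\<close>

lemma prod_Basis_vec: "(\<Prod>b\<in>(Basis::(real^'n) set). g b) = (\<Prod>i\<in>UNIV. g (axis i (1::real)))"
proof -
  have "bij_betw (\<lambda>i::'n. axis i (1::real)) UNIV Basis"
    by (auto simp: bij_betw_def inj_on_def axis_eq_axis Basis_vec_def)
  from prod.reindex_bij_betw[OF this, of g] show ?thesis by simp
qed

lemma box_vec_eq: "box l u = {x::real^'n. \<forall>i. x $ i \<in> {l $ i<..<u $ i}}"
  by (auto simp: box_def Basis_vec_def inner_axis)

lemma measurable_vec_lambda_PiM [measurable]:
  "(\<lambda>f. \<chi> i. f i) \<in> (\<Pi>\<^sub>M i\<in>UNIV. lborel) \<rightarrow>\<^sub>M (borel :: (real^'n) measure)"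
  by (rule borel_measurable_euclidean_space[THEN iffD2])
    (auto simp: Basis_vec_def inner_axis)

text \<open>Open boxes determine Lebesgue measure, and both sides give a box the product of its side
  lengths. The product form lets a single coordinate be integrated out.\<close>

lemma lborel_vec_eq_distr_PiM:
  "(lborel :: (real^'n) measure) = distr (\<Pi>\<^sub>M i\<in>UNIV. lborel) borel (\<lambda>f. \<chi> i. f i)"
proof (rule lborel_eqI)
  interpret product_sigma_finite "\<lambda>i::'n. lborel :: real measure" ..
  fix l u :: "real^'n" assume le: "\<And>b. b \<in> Basis \<Longrightarrow> l \<bullet> b \<le> u \<bullet> b"
  have le': "l $ i \<le> u $ i" for i
    using le[of "axis i 1"] by (simp add: inner_axis)
  have "emeasure (distr (\<Pi>\<^sub>M i\<in>UNIV. lborel) borel (\<lambda>f. \<chi> i. f i)) (box l u)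
      = emeasure (\<Pi>\<^sub>M i\<in>UNIV. lborel) (\<Pi>\<^sub>E i\<in>UNIV. {l $ i<..<u $ i})"
    by (subst emeasure_distr)
      (auto simp: box_vec_eq space_PiM intro!: arg_cong[where f="emeasure _"])
  also have "\<dots> = (\<Prod>i\<in>UNIV. ennreal (u $ i - l $ i))"
    by (subst emeasure_PiM) (auto intro!: prod.cong simp: le')
  also have "\<dots> = (\<Prod>b\<in>Basis. (u - l) \<bullet> b)"
    by (simp add: prod_Basis_vec inner_axis prod_ennreal le')
  finally show "emeasure (distr (\<Pi>\<^sub>M i\<in>UNIV. lborel) borel (\<lambda>f. \<chi> i. f i)) (box l u)
      = (\<Prod>b\<in>Basis. (u - l) \<bullet> b)" .
qed simp

lemma nn_integral_lborel_vec:
  assumes [measurable]: "h \<in> borel_measurable borel"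
  shows "(\<integral>\<^sup>+x. h (x::real^'n) \<partial>lborel) = (\<integral>\<^sup>+f. h (\<chi> i. f i) \<partial>(\<Pi>\<^sub>M i\<in>UNIV. lborel))"
  by (subst lborel_vec_eq_distr_PiM) (simp add: nn_integral_distr)

text \<open>With the other coordinates held fixed, the shear is a translation of coordinate
  \<open>m\<close>, under which one-dimensional Lebesgue measure is invariant.\<close>

lemma nn_integral_lborel_shear:
  fixes h :: "real^'n \<Rightarrow> ennreal"
  assumes h[measurable]: "h \<in> borel_measurable borel" and mn: "m \<noteq> n"
  shows "(\<integral>\<^sup>+x. h (\<chi> i. if i = m then x $ m + x $ n else x $ i) \<partial>lborel) = (\<integral>\<^sup>+x. h x \<partial>lborel)"
proof -
  interpret product_sigma_finite "\<lambda>i::'n. lborel :: real measure" ..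
  have un: "UNIV = insert m (UNIV - {m})" by auto
  let ?P = "\<lambda>I. Pi\<^sub>M I (\<lambda>i::'n. lborel :: real measure)"
  have ins: "(\<integral>\<^sup>+f. g f \<partial>?P UNIV) = (\<integral>\<^sup>+f. \<integral>\<^sup>+y. g (f(m := y)) \<partial>lborel \<partial>?P (UNIV - {m}))"
    if "g \<in> borel_measurable (?P UNIV)" for g :: "_ \<Rightarrow> ennreal"
    using product_nn_integral_insert[of "UNIV - {m}" m g] that un by (metis DiffD2 finite insertI1)
  have [measurable]: "(\<lambda>x::real^'n. \<chi> i. if i = m then x $ m + x $ n else x $ i) \<in> borel_measurable borel"
    by (rule borel_measurable_euclidean_space[THEN iffD2]) (auto simp: Basis_vec_def inner_axis)
  have "(\<integral>\<^sup>+x. h (\<chi> i. if i = m then x $ m + x $ n else x $ i) \<partial>lborel)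
      = (\<integral>\<^sup>+f. h (\<chi> i. if i = m then f m + f n else f i) \<partial>?P UNIV)"
    by (subst nn_integral_lborel_vec) (auto intro!: nn_integral_cong arg_cong[where f=h] simp: vec_eq_iff)
  \<comment> \<open>Since \<open>m \<noteq> n\<close>, integrating over coordinate \<open>m\<close>
    first leaves the shift \<open>f n\<close> constant.\<close>
  also have "\<dots> = (\<integral>\<^sup>+f. \<integral>\<^sup>+y. h (\<chi> i. if i = m then y + f n else f i) \<partial>lborel \<partial>?P (UNIV - {m}))"
  proof (subst ins)
    have "(\<lambda>f::'n\<Rightarrow>real. \<chi> i. if i = m then f m + f n else f i) \<in> ?P UNIV \<rightarrow>\<^sub>M borel"
      by (rule borel_measurable_euclidean_space[THEN iffD2]) (auto simp: Basis_vec_def inner_axis)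
    then show "(\<lambda>f. h (\<chi> i. if i = m then f m + f n else f i)) \<in> borel_measurable (?P UNIV)" by simp
  qed (use mn in \<open>auto intro!: nn_integral_cong arg_cong[where f=h] simp: vec_eq_iff\<close>)
  also have "\<dots> = (\<integral>\<^sup>+f. \<integral>\<^sup>+y. h (\<chi> i. if i = m then y else f i) \<partial>lborel \<partial>?P (UNIV - {m}))"
  proof (rule nn_integral_cong)
    fix f :: "'n \<Rightarrow> real"
    have "(\<lambda>y. \<chi> i. if i = m then y else f i) \<in> borel_measurable (borel::real measure)"
      by (rule borel_measurable_euclidean_space[THEN iffD2]) (auto simp: Basis_vec_def inner_axis)
    then have "(\<lambda>y. h (\<chi> i. if i = m then y else f i)) \<in> borel_measurable borel" by simp
    from nn_integral_real_affine[OF this, of 1 "f n"]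
    show "(\<integral>\<^sup>+y. h (\<chi> i. if i = m then y + f n else f i) \<partial>lborel) = (\<integral>\<^sup>+y. h (\<chi> i. if i = m then y else f i) \<partial>lborel)"
      by (simp only: abs_one ennreal_1 mult_1 add.commute[of "f n"])
  qed
  also have "\<dots> = (\<integral>\<^sup>+f. h (\<chi> i. f i) \<partial>?P UNIV)"
    by (subst ins) (auto intro!: nn_integral_cong arg_cong[where f=h] simp: vec_eq_iff)
  also have "\<dots> = (\<integral>\<^sup>+x. h x \<partial>lborel)"
    by (subst nn_integral_lborel_vec) auto
  finally show ?thesis .
qed

text \<open>The preimage of a box is the box with two sides exchanged, and the product of the side
  lengths does not change under the exchange.\<close>

lemma lborel_eq_distr_transpose:
  "(lborel :: (real^'n) measure) = distr lborel borel (\<lambda>x. \<chi> i. x $ Transposition.transpose m n i)"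
proof (rule lborel_eqI)
  let ?t = "Transposition.transpose m n"
  fix l u :: "real^'n" assume le: "\<And>b. b \<in> Basis \<Longrightarrow> l \<bullet> b \<le> u \<bullet> b"
  have le': "l $ i \<le> u $ i" for i
    using le[of "axis i 1"] by (simp add: inner_axis)
  have [measurable]: "(\<lambda>x::real^'n. \<chi> i. x $ ?t i) \<in> borel_measurable borel"
    by (rule borel_measurable_euclidean_space[THEN iffD2]) (auto simp: Basis_vec_def inner_axis)
  have vim: "(\<lambda>x. \<chi> i. x $ ?t i) -` box l u = box (\<chi> i. l $ ?t i) (\<chi> i. u $ ?t i)"
    unfolding box_vec_eq by (auto) (metis transpose_involutory)+
  have "emeasure (distr lborel borel (\<lambda>x. \<chi> i. x $ ?t i)) (box l u)
      = emeasure lborel (box (\<chi> i. l $ ?t i) (\<chi> i. u $ ?t i))"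
    by (subst emeasure_distr) (auto simp: vim)
  also have "\<dots> = (\<Prod>i\<in>UNIV. u $ ?t i - l $ ?t i)"
  proof (subst emeasure_lborel_box)
    show "(\<chi> i. l $ ?t i) \<bullet> b \<le> (\<chi> i. u $ ?t i) \<bullet> b" if "b \<in> Basis" for b
      using that by (auto simp: Basis_vec_def inner_axis le')
  qed (simp add: prod_Basis_vec inner_axis)
  also have "(\<Prod>i\<in>UNIV. u $ ?t i - l $ ?t i) = (\<Prod>i\<in>UNIV. u $ i - l $ i)"
    by (rule prod.reindex_bij_betw[of ?t UNIV UNIV "\<lambda>i. u $ i - l $ i"]) simp
  also have "\<dots> = (\<Prod>b\<in>Basis. (u - l) \<bullet> b)"
    by (simp add: prod_Basis_vec inner_axis)
  finally show "emeasure (distr lborel borel (\<lambda>x. \<chi> i. x $ ?t i)) (box l u) = (\<Prod>b\<in>Basis. (u - l) \<bullet> b)" .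
qed simp

text \<open>Induction over the elementary factors of a linear map, along which determinants
  multiply. \<open>P\<close> contains injectivity, so that a map with a vanishing coordinate
  satisfies it vacuously, and it quantifies over \<open>h\<close>, because for a composition the
  hypothesis on \<open>g\<close> is applied to \<open>h\<close> composed with
  \<open>f\<close>.\<close>

lemma nn_integral_lborel_linear:
  fixes f :: "real^'n \<Rightarrow> real^'n" and h :: "real^'n \<Rightarrow> ennreal"
  assumes "linear f" "inj f" "h \<in> borel_measurable borel"
  shows "ennreal \<bar>det (matrix f)\<bar> * (\<integral>\<^sup>+x. h (f x) \<partial>lborel) = (\<integral>\<^sup>+x. h x \<partial>lborel)"
proof -
  define P where "P \<equiv> \<lambda>f :: real^'n \<Rightarrow> real^'n. linear f \<longrightarrow> inj f \<longrightarrow> (\<forall>h\<in>borel_measurable borel.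
    ennreal \<bar>det (matrix f)\<bar> * (\<integral>\<^sup>+x. h (f x) \<partial>lborel) = (\<integral>\<^sup>+x. h x \<partial>lborel))"
  have "P f"
  proof (rule induct_linear_elementary[OF \<open>linear f\<close>])
    fix f g :: "real^'n \<Rightarrow> real^'n" assume lin: "linear f" "linear g" and P: "P f" "P g"
    show "P (f \<circ> g)" unfolding P_def
    proof (intro impI ballI)
      fix h :: "real^'n \<Rightarrow> ennreal" assume "inj (f \<circ> g)" and h[measurable]: "h \<in> borel_measurable borel"
      \<comment> \<open>Both factors have to be injective: \<open>g\<close> is also surjective by
        finite dimension, so \<open>f\<close> inherits injectivity from the composition.\<close>
      then have "inj g" by (simp add: inj_on_imageI2)
      then have "surj g" using lin linear_injective_imp_surjective by blast
      then have "inj f" using \<open>inj (f \<circ> g)\<close> by (metis inj_on_imageI)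
      have [measurable]: "f \<in> borel_measurable borel"
        using lin by (simp add: borel_measurable_continuous_onI linear_continuous_on linear_linear)
      have "ennreal \<bar>det (matrix (f \<circ> g))\<bar> * (\<integral>\<^sup>+x. h ((f \<circ> g) x) \<partial>lborel)
        = ennreal \<bar>det (matrix f)\<bar> * (ennreal \<bar>det (matrix g)\<bar> * (\<integral>\<^sup>+x. h (f (g x)) \<partial>lborel))"
        using lin by (simp add: matrix_compose det_mul abs_mult ennreal_mult mult.assoc)
      also have "(ennreal \<bar>det (matrix g)\<bar> * (\<integral>\<^sup>+x. h (f (g x)) \<partial>lborel)) = (\<integral>\<^sup>+x. h (f x) \<partial>lborel)"
        using P(2)[unfolded P_def, rule_format, OF lin(2) \<open>inj g\<close>, of "\<lambda>x. h (f x)"] by simp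
      also have "ennreal \<bar>det (matrix f)\<bar> * \<dots> = (\<integral>\<^sup>+x. h x \<partial>lborel)"
        using P(1) lin \<open>inj f\<close> h unfolding P_def by blast
      finally show "ennreal \<bar>det (matrix (f \<circ> g))\<bar> * (\<integral>\<^sup>+x. h ((f \<circ> g) x) \<partial>lborel) = (\<integral>\<^sup>+x. h x \<partial>lborel)" .
    qed
  next
    fix f :: "real^'n \<Rightarrow> real^'n" and i assume f: "linear f" and z: "\<And>x. f x $ i = 0"
    have "\<not> inj f"
    proof
      assume "inj f"
      then have "surj f" using f linear_injective_imp_surjective by blast
      then obtain x where "f x = axis i 1" by (metis surj_def)
      then show False using z[of x] by simp
    qed
    then show "P f" by (simp add: P_def)
  next
    fix c :: "'n \<Rightarrow> real"
    let ?f = "\<lambda>x::real^'n. \<chi> i. c i * x $ i"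
    show "P ?f" unfolding P_def
    proof (intro impI ballI)
      fix h :: "real^'n \<Rightarrow> ennreal" assume "inj ?f" and h[measurable]: "h \<in> borel_measurable borel"
      have c: "c i \<noteq> 0" for i
      proof
        assume "c i = 0"
        then have "?f (axis i 1) = ?f 0" by (auto simp: vec_eq_iff axis_def)
        from injD[OF \<open>inj ?f\<close> this] show False by simp
      qed
      have [measurable]: "?f \<in> borel_measurable borel"
        by (rule borel_measurable_euclidean_space[THEN iffD2]) (auto simp: Basis_vec_def inner_axis)
      \<comment> \<open>\<open>lborel_affine_euclidean\<close> takes its scaling factors indexed by
        basis vectors, so \<open>c'\<close> recovers the index \<open>i\<close> from
        \<open>axis i 1\<close>.\<close>
      define c' where "c' b = c (THE i. b = axis i (1::real))" for b
      have c': "c' (axis i 1) = c i" for i by (simp add: c'_def axis_eq_axis)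
      have T: "0 + (\<Sum>j\<in>Basis. (c' j * (x \<bullet> j)) *\<^sub>R j) = ?f x" for x :: "real^'n"
        by (rule euclidean_eqI) (auto simp: inner_sum_left inner_Basis Basis_vec_def inner_axis c'
          if_distrib cong: if_cong)
      have "(lborel :: (real^'n) measure) = density (distr lborel borel ?f) (\<lambda>_. (\<Prod>j\<in>Basis. \<bar>c' j\<bar>))"
      proof -
        have "c' j \<noteq> 0" if "j \<in> Basis" for j
          using that c by (auto simp: Basis_vec_def c')
        from lborel_affine_euclidean[of c' 0, OF this] show ?thesis by (simp only: T)
      qed
      then have "(\<integral>\<^sup>+x. h x \<partial>lborel) = (\<integral>\<^sup>+x. h x \<partial>density (distr lborel borel ?f) (\<lambda>_. (\<Prod>j\<in>Basis. \<bar>c' j\<bar>)))"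
        by simp
      also have "\<dots> = (\<Prod>j\<in>Basis. \<bar>c' j\<bar>) * (\<integral>\<^sup>+x. h (?f x) \<partial>lborel)"
        by (subst nn_integral_density) (auto simp: nn_integral_cmult nn_integral_distr)
      also have "(\<Prod>j\<in>Basis. \<bar>c' j\<bar>) = \<bar>det (matrix ?f)\<bar>"
        unfolding prod_Basis_vec c' by (subst det_diagonal) (auto simp: matrix_def axis_def abs_prod)
      finally show "ennreal \<bar>det (matrix ?f)\<bar> * (\<integral>\<^sup>+x. h (?f x) \<partial>lborel) = (\<integral>\<^sup>+x. h x \<partial>lborel)" by simp
    qed
  next
    fix m n :: 'n assume "m \<noteq> n"
    let ?t = "Transposition.transpose m n"
    let ?f = "\<lambda>x::real^'n. \<chi> i. x $ ?t i"
    have [measurable]: "?f \<in> borel_measurable borel"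
      by (rule borel_measurable_euclidean_space[THEN iffD2]) (auto simp: Basis_vec_def inner_axis)
    have "matrix ?f = (\<chi> i. (mat 1 :: real^'n^'n) $ ?t i)"
      by (auto simp: matrix_def mat_def vec_eq_iff axis_def)
    then have d: "\<bar>det (matrix ?f)\<bar> = 1"
      by (simp add: det_permute_rows permutes_swap_id sign_swap_id abs_mult)
    show "P ?f" unfolding P_def
      by (auto simp: d) (subst (2) lborel_eq_distr_transpose[of m n], simp add: nn_integral_distr)
  next
    fix m n :: 'n assume mn: "m \<noteq> n"
    let ?f = "\<lambda>x::real^'n. \<chi> i. if i = m then x $ m + x $ n else x $ i"
    have "matrix ?f = (\<chi> k. if k = m then row m (mat 1) + 1 *s row n (mat 1) else row k (mat 1))"
      by (auto simp: matrix_def mat_def vec_eq_iff axis_def row_def)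
    then have "det (matrix ?f) = 1"
      by (simp only: det_row_operation[OF mn] det_I)
    then show "P ?f" unfolding P_def by (auto simp: nn_integral_lborel_shear mn)
  qed
  with assms show ?thesis by (auto simp: P_def)
qed

lemma nn_integral_lborel_affine:
  fixes h :: "'a::euclidean_space \<Rightarrow> ennreal"
  assumes [measurable]: "h \<in> borel_measurable borel" and "c \<noteq> 0"
  shows "(\<integral>\<^sup>+x. h x \<partial>lborel) = ennreal (\<bar>c\<bar> ^ DIM('a)) * (\<integral>\<^sup>+x. h (t + c *\<^sub>R x) \<partial>lborel)"
  by (subst lborel_affine[OF \<open>c \<noteq> 0\<close>, of t])
    (simp add: nn_integral_density nn_integral_distr nn_integral_cmult)

section \<open>Product measures\<close>

text \<open>Testing with indicator functions gives equality on sets. This turns the integral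
  identities for sums of normal vectors into identities of laws.\<close>

lemma distr_eqI_nn_integral:
  assumes f[measurable]: "f \<in> M \<rightarrow>\<^sub>M N" and s[measurable_cong]: "sets N' = sets N"
    and eq: "\<And>h. h \<in> borel_measurable N \<Longrightarrow> (\<integral>\<^sup>+x. h (f x) \<partial>M) = (\<integral>\<^sup>+x. h x \<partial>N')"
  shows "distr M N f = N'"
proof (rule measure_eqI)
  fix A assume "A \<in> sets (distr M N f)"
  then have [measurable]: "A \<in> sets N" by simp
  have "emeasure (distr M N f) A = (\<integral>\<^sup>+x. indicator A x \<partial>distr M N f)" by simp
  also have "\<dots> = (\<integral>\<^sup>+x. indicator A (f x) \<partial>M)" by (rule nn_integral_distr) auto
  also have "\<dots> = (\<integral>\<^sup>+x. indicator A x \<partial>N')" by (rule eq) simp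
  also have "\<dots> = emeasure N' A" using s by simp
  finally show "emeasure (distr M N f) A = emeasure N' A" .
qed (simp add: s)

lemma product_sigma_finite_prob: "(\<And>i. prob_space (M i)) \<Longrightarrow> product_sigma_finite M"
  by (simp add: product_sigma_finite_def prob_space_imp_sigma_finite)

text \<open>The entries of the grid are independent, so blocks on disjoint rows are independent, and
  so are the row statistics \<open>g t\<close>. Independence is then read back as a product
  law.\<close>

lemma distr_PiM_rows:
  assumes M: "prob_space M" and I: "I \<noteq> {}" and J: "J \<noteq> {}"
    and g: "\<And>t. t \<in> I \<Longrightarrow> g t \<in> PiM J (\<lambda>_. M) \<rightarrow>\<^sub>M N"
  shows "distr (PiM (I \<times> J) (\<lambda>_. M)) (PiM I (\<lambda>_. N)) (\<lambda>X. \<lambda>t\<in>I. g t (\<lambda>k\<in>J. X (t, k)))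
    = PiM I (\<lambda>t. distr (PiM J (\<lambda>_. M)) N (g t))"
proof -
  let ?P = "PiM (I \<times> J) (\<lambda>_. M)"
  interpret P: prob_space ?P by (intro prob_space_PiM M)
  have "P.indep_vars (\<lambda>_. M) (\<lambda>p X. X p) (I \<times> J)"
  proof (subst P.indep_vars_iff_distr_eq_PiM')
    have "distr ?P ?P (\<lambda>X. \<lambda>p\<in>I \<times> J. X p) = distr ?P ?P (\<lambda>X. X)"
      by (intro distr_cong) (auto simp: space_PiM extensional_restrict PiE_iff)
    also have "\<dots> = PiM (I \<times> J) (\<lambda>p. distr ?P M (\<lambda>X. X p))"
      using distr_PiM_component[of "I \<times> J" "\<lambda>_. M"] M by (auto intro!: PiM_cong)
    finally show "distr ?P ?P (\<lambda>X. \<lambda>p\<in>I \<times> J. X p) = PiM (I \<times> J) (\<lambda>p. distr ?P M (\<lambda>X. X p))" .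
  qed (use I J in auto)
  then have "P.indep_vars (\<lambda>t. PiM ({t} \<times> J) (\<lambda>_. M)) (\<lambda>t X. \<lambda>p\<in>{t} \<times> J. X p) I"
    by (rule P.indep_vars_restrict) (auto simp: disjoint_family_on_def)
  then have "P.indep_vars (\<lambda>_. N) (\<lambda>t X. g t (\<lambda>k\<in>J. (\<lambda>p\<in>{t} \<times> J. X p) (t, k))) I"
  proof (rule P.indep_vars_compose2)
    fix t assume "t \<in> I"
    then have [measurable]: "g t \<in> PiM J (\<lambda>_. M) \<rightarrow>\<^sub>M N" by (rule g)
    show "(\<lambda>Y. g t (\<lambda>k\<in>J. Y (t, k))) \<in> PiM ({t} \<times> J) (\<lambda>_. M) \<rightarrow>\<^sub>M N" by measurable
  qed
  also have "(\<lambda>t X. g t (\<lambda>k\<in>J. (\<lambda>p\<in>{t} \<times> J. X p) (t, k))) = (\<lambda>t X. g t (\<lambda>k\<in>J. X (t, k)))"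
    by (auto intro!: ext arg_cong[where f="g _"])
  finally have ind: "P.indep_vars (\<lambda>_. N) (\<lambda>t X. g t (\<lambda>k\<in>J. X (t, k))) I" .
  have row[measurable]: "(\<lambda>X. \<lambda>k\<in>J. X (t, k)) \<in> ?P \<rightarrow>\<^sub>M PiM J (\<lambda>_. M)" if "t \<in> I" for t
    using that by (intro measurable_restrict measurable_component_singleton) auto
  have "distr ?P (PiM I (\<lambda>_. N)) (\<lambda>X. \<lambda>t\<in>I. g t (\<lambda>k\<in>J. X (t, k)))
    = PiM I (\<lambda>t. distr ?P N (\<lambda>X. g t (\<lambda>k\<in>J. X (t, k))))"
    using ind by (subst (asm) P.indep_vars_iff_distr_eq_PiM'[OF I]) (auto intro: measurable_compose[OF row g])
  also have "\<dots> = PiM I (\<lambda>t. distr (PiM J (\<lambda>_. M)) N (g t))"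
  proof (intro PiM_cong refl)
    fix t assume t: "t \<in> I"
    have "distr ?P N (\<lambda>X. g t (\<lambda>k\<in>J. X (t, k))) = distr (distr ?P (PiM J (\<lambda>_. M)) (\<lambda>X. \<lambda>k\<in>J. X (t, k))) N (g t)"
      by (subst distr_distr[OF g[OF t] row[OF t]]) (simp add: o_def)
    also have "distr ?P (PiM J (\<lambda>_. M)) (\<lambda>X. \<lambda>k\<in>J. X (t, k)) = PiM J (\<lambda>_. M)"
      using t M by (intro distr_PiM_reindex[of "I \<times> J" "\<lambda>_. M" "\<lambda>k. (t, k)" J]) (auto simp: inj_on_def)
    finally show "distr ?P N (\<lambda>X. g t (\<lambda>k\<in>J. X (t, k))) = distr (PiM J (\<lambda>_. M)) N (g t)" .
  qed
  finally show ?thesis .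
qed

text \<open>A product measure is determined by its values on rectangles, and over a rectangle the
  integral of the product density splits into one factor per coordinate.\<close>

lemma PiM_density:
  assumes I: "finite I" and "product_sigma_finite M" and "product_sigma_finite (\<lambda>i. density (M i) (f i))"
    and f[measurable]: "\<And>i. f i \<in> borel_measurable (M i)"
  shows "PiM I (\<lambda>i. density (M i) (f i)) = density (PiM I M) (\<lambda>x. \<Prod>i\<in>I. f i (x i))"
proof -
  interpret M: product_sigma_finite M by fact
  interpret D: product_sigma_finite "\<lambda>i. density (M i) (f i)" by fact
  have [measurable]: "(\<lambda>x. \<Prod>i\<in>I. f i (x i)) \<in> borel_measurable (PiM I M)"
    by (intro borel_measurable_prod_ennreal measurable_compose[OF _ f] measurable_component_singleton)
  have "density (PiM I M) (\<lambda>x. \<Prod>i\<in>I. f i (x i)) = PiM I (\<lambda>i. density (M i) (f i))"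
  proof (rule D.PiM_eqI[OF I])
    show "sets (density (PiM I M) (\<lambda>x. \<Prod>i\<in>I. f i (x i))) = sets (PiM I (\<lambda>i. density (M i) (f i)))"
      by (simp cong: sets_PiM_cong)
    fix A assume "\<And>i. i \<in> I \<Longrightarrow> A i \<in> sets (density (M i) (f i))"
    then have A[measurable]: "\<And>i. i \<in> I \<Longrightarrow> A i \<in> sets (M i)" by simp
    have "PiE I A \<in> sets (PiM I M)" using I A by (auto intro!: sets_PiM_I_finite)
    then have "emeasure (density (PiM I M) (\<lambda>x. \<Prod>i\<in>I. f i (x i))) (PiE I A)
        = (\<integral>\<^sup>+x. (\<Prod>i\<in>I. f i (x i)) * indicator (PiE I A) x \<partial>PiM I M)"
      by (simp add: emeasure_density)
    also have "\<dots> = (\<integral>\<^sup>+x. (\<Prod>i\<in>I. f i (x i) * indicator (A i) (x i)) \<partial>PiM I M)"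
    proof (rule nn_integral_cong)
      fix x assume "x \<in> space (PiM I M)"
      \<comment> \<open>Points of the product space are extensional, so lying in the rectangle is a
        condition on the coordinates in \<open>I\<close> alone.\<close>
      then have "indicator (PiE I A) x = (\<Prod>i\<in>I. indicator (A i) (x i) :: ennreal)"
        using I by (auto simp: indicator_def space_PiM PiE_iff)
      then show "(\<Prod>i\<in>I. f i (x i)) * indicator (PiE I A) x = (\<Prod>i\<in>I. f i (x i) * indicator (A i) (x i))"
        by (simp add: prod.distrib)
    qed
    also have "\<dots> = (\<Prod>i\<in>I. \<integral>\<^sup>+x. f i x * indicator (A i) x \<partial>M i)"
      using I by (intro M.product_nn_integral_prod) auto
    also have "\<dots> = (\<Prod>i\<in>I. emeasure (density (M i) (f i)) (A i))"
      by (intro prod.cong) (auto simp: emeasure_density)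
    finally show "emeasure (density (PiM I M) (\<lambda>x. \<Prod>i\<in>I. f i (x i))) (PiE I A)
      = (\<Prod>i\<in>I. emeasure (density (M i) (f i)) (A i))" .
  qed
  then show ?thesis by simp
qed

section \<open>Whitening a positive definite matrix\<close>

lemma matrix_inv_eqI:
  fixes A B :: "real^'n^'n"
  assumes "A ** B = mat 1"
  shows "matrix_inv A = B"
proof -
  have BA: "B ** A = mat 1" using assms matrix_left_right_inverse by blast
  then have "invertible A" using assms invertible_def by blast
  then have "matrix_inv A ** A = mat 1"
    unfolding invertible_def matrix_inv_def by (rule someI2_ex) auto
  then have "matrix_inv A ** A ** B = B" by simp
  then show ?thesis using assms by (simp add: matrix_mul_assoc[symmetric])
qed

text \<open>Gram-Schmidt for the inner product \<open>x \<bullet> (S *v y)\<close>, in extremal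
  form: an orthonormal set of largest cardinality spans, since otherwise the normalised residual of
  a vector outside its span would enlarge it.\<close>

lemma pos_def_mat_orthonormal_basis:
  fixes S :: "real^'n^'n"
  assumes "pos_def_mat S"
  shows "\<exists>e. \<forall>i j. e i \<bullet> (S *v e j) = (if i = (j::'n) then 1 else 0)"
proof -
  define s where "s x y = x \<bullet> (S *v y)" for x y
  have sym: "s x y = s y x" for x y
  proof -
    have "s x y = (transpose S *v x) \<bullet> y" unfolding s_def
      by (metis dot_lmul_matrix vector_transpose_matrix transpose_transpose)
    moreover have "transpose S = S" using assms by (simp add: pos_def_mat_def)
    ultimately show ?thesis unfolding s_def by (metis inner_commute)
  qed
  have pos: "s x x > 0" if "x \<noteq> 0" for x
    using assms that by (simp add: s_def pos_def_mat_def)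
  have s_sum: "s (\<Sum>v\<in>C. u v *\<^sub>R v) y = (\<Sum>v\<in>C. u v * s v y)" for C u y
    by (simp add: s_def inner_sum_left)
  define ON where "ON C \<longleftrightarrow> finite C \<and> (\<forall>x\<in>C. \<forall>y\<in>C. s x y = (if x = y then 1 else 0))" for C
  have ON_coeff: "s (\<Sum>v\<in>C. u v *\<^sub>R v) w = u w" if "ON C" "w \<in> C" for C u w
  proof -
    have "s (\<Sum>v\<in>C. u v *\<^sub>R v) w = (\<Sum>v\<in>C. if v = w then u v else 0)"
      unfolding s_sum using that by (intro sum.cong) (auto simp: ON_def)
    then show ?thesis using that by (simp add: ON_def)
  qed
  have ind: "independent C" if "ON C" for C
  proof (rule independent_if_scalars_zero)
    show "finite C" using that by (simp add: ON_def)
    fix u w assume "(\<Sum>x\<in>C. u x *\<^sub>R x) = 0" "w \<in> C"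
    with ON_coeff[OF that \<open>w \<in> C\<close>, of u] show "u w = 0" by (simp add: s_def)
  qed
  \<comment> \<open>Orthonormal sets are independent, so the dimension bounds their size and a
    largest one exists.\<close>
  have bound: "\<forall>C. ON C \<longrightarrow> card C < Suc CARD('n)"
    using independent_bound[OF ind] by (auto simp: less_Suc_eq_le)
  have "ON {}" by (simp add: ON_def)
  from ex_has_greatest_nat[of ON, OF this bound]
  obtain C where C: "ON C" and max: "\<And>D. ON D \<Longrightarrow> card D \<le> card C" by blast
  have "x \<in> span C" for x
  proof (rule ccontr)
    assume x: "x \<notin> span C"
    \<comment> \<open>\<open>y\<close> is the residual of \<open>x\<close> after orthogonal
      projection to the span of \<open>C\<close>.\<close>
    define y where "y = x - (\<Sum>v\<in>C. s x v *\<^sub>R v)"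
    have "y \<noteq> 0"
    proof
      assume "y = 0"
      then have "x = (\<Sum>v\<in>C. s x v *\<^sub>R v)" by (simp add: y_def)
      also have "\<dots> \<in> span C" by (intro span_sum span_scale span_base)
      finally show False using x by simp
    qed
    have yC: "s y w = 0" if "w \<in> C" for w
    proof -
      have "s y w = s x w - s (\<Sum>v\<in>C. s x v *\<^sub>R v) w" by (simp add: y_def s_def inner_diff_left)
      then show ?thesis using ON_coeff[OF C that] by simp
    qed
    define w where "w = (1 / sqrt (s y y)) *\<^sub>R y"
    have sw: "s w v = s y v / sqrt (s y y)" for v by (simp add: w_def s_def)
    have ww: "s w w = 1"
    proof -
      have "s w w = s w y / sqrt (s y y)" using sw[of w] sym[of y w] by simp
      also have "\<dots> = s y y / (sqrt (s y y) * sqrt (s y y))" by (simp add: sw)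
      finally show ?thesis using pos[OF \<open>y \<noteq> 0\<close>] by simp
    qed
    have wC: "s w v = 0" "s v w = 0" if "v \<in> C" for v
      using yC[OF that] sw[of v] sym[of v w] by auto
    then have "w \<notin> C" using ww by force
    have "ON (insert w C)" using C wC ww by (auto simp: ON_def)
    from max[OF this] show False using \<open>w \<notin> C\<close> C by (simp add: ON_def)
  qed
  then have "span C = UNIV" by auto
  then have "card C = CARD('n)"
    using dim_eq_card_independent[OF ind[OF C]] by (metis dim_UNIV dim_span DIM_cart DIM_real mult.right_neutral)
  \<comment> \<open>Indexing the basis by \<open>'n\<close> makes it available as the rows of a
    square matrix.\<close>
  then obtain e where "bij_betw e (UNIV :: 'n set) C"
    using finite_same_card_bij[of "UNIV :: 'n set" C] C by (auto simp: ON_def)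
  then have "s (e i) (e j) = (if i = j then 1 else 0)" for i j
    using C by (auto simp: ON_def bij_betw_def inj_eq)
  then show ?thesis unfolding s_def by blast
qed

text \<open>Take an orthonormal basis for the form of \<open>S\<close> as the rows of
  \<open>B\<close>. Then \<open>B ** S ** transpose B\<close> is the identity, which yields the
  factorisation of the inverse and, by taking determinants, the second claim.\<close>

lemma pos_def_mat_inv_factor:
  fixes S :: "real^'n^'n"
  assumes "pos_def_mat S"
  shows "\<exists>B. (\<forall>x y. x \<bullet> (matrix_inv S *v y) = (B *v x) \<bullet> (B *v y)) \<and> (det B)\<^sup>2 * det S = 1"
proof -
  obtain e where e: "\<And>i j. e i \<bullet> (S *v e j) = (if i = (j::'n) then 1 else 0)"
    using pos_def_mat_orthonormal_basis[OF assms] by blast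
  define B where "B = (\<chi> i. e i)"
  have "(B ** (S ** transpose B)) $ i $ j = e i \<bullet> (S *v e j)" for i j
    unfolding matrix_matrix_mult_def matrix_vector_mult_def inner_vec_def transpose_def B_def by simp
  then have 1: "B ** (S ** transpose B) = mat 1"
    by (simp add: vec_eq_iff e mat_def)
  \<comment> \<open>A one-sided inverse of a square matrix is two-sided, so \<open>B\<close> may
    move from the left end of the product to the right.\<close>
  then have "S ** transpose B ** B = mat 1" using matrix_left_right_inverse by blast
  then have inv: "matrix_inv S = transpose B ** B"
    by (intro matrix_inv_eqI) (simp add: matrix_mul_assoc)
  have "x \<bullet> (matrix_inv S *v y) = (B *v x) \<bullet> (B *v y)" for x y
    unfolding inv by (metis dot_lmul_matrix matrix_vector_mul_assoc vector_transpose_matrix transpose_transpose)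
  moreover have "(det B)\<^sup>2 * det S = 1"
    using arg_cong[OF 1, of det] by (simp add: det_mul det_transpose power2_eq_square mult_ac)
  ultimately show ?thesis by blast
qed

section \<open>Multivariate normal distributions\<close>

text \<open>With \<open>x \<bullet> (S\<^sup>-\<^sup>1 *v y) = (B *v x) \<bullet> (B *v y)\<close>, this is the density of the normal
  distribution with mean \<open>m\<close> and covariance \<open>a *\<^sub>R S\<close>.\<close>
definition gdens :: "real^'d^'d \<Rightarrow> real \<Rightarrow> real^'d \<Rightarrow> real^'d \<Rightarrow> real" where
  "gdens B a m x = \<bar>det B\<bar> * exp (- (norm (B *v (x - m)))\<^sup>2 / (2 * a)) / sqrt (2 * pi * a) ^ CARD('d)"

definition gmeas :: "real^'d^'d \<Rightarrow> real \<Rightarrow> real^'d \<Rightarrow> (real^'d) measure" where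
  "gmeas B a m = density lborel (\<lambda>x. ennreal (gdens B a m x))"

text \<open>The quadratic forms agree by the choice of \<open>B\<close>, and the normalising
  constants agree because the square root of \<open>det S\<close> is the reciprocal of
  \<open>\<bar>det B\<bar>\<close>.\<close>

lemma gauss_measure_eq_gmeas:
  fixes S :: "real^'d^'d"
  assumes "\<And>x y. x \<bullet> (matrix_inv S *v y) = (B *v x) \<bullet> (B *v y)" and B: "(det B)\<^sup>2 * det S = 1"
  shows "gauss_measure mu S = gmeas B 1 mu"
proof -
  have "det S = 1 / (det B)\<^sup>2" using B by (cases "det B = 0") (auto simp: field_simps)
  then have "sqrt ((2 * pi) ^ CARD('d) * det S) = sqrt (2 * pi) ^ CARD('d) / \<bar>det B\<bar>"
    by (simp add: real_sqrt_divide flip: real_sqrt_power)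
  then have "gauss_density mu S x = gdens B 1 mu x" for x
    by (simp add: gauss_density_def gdens_def assms(1) power2_norm_eq_inner)
  then show ?thesis by (simp add: gauss_measure_def gmeas_def)
qed

lemma gdens_nonneg [simp]: "a \<ge> 0 \<Longrightarrow> gdens B a m x \<ge> 0"
  by (simp add: gdens_def)

lemma gdens_pos: "a > 0 \<Longrightarrow> det B \<noteq> 0 \<Longrightarrow> gdens B a m x > 0"
  by (simp add: gdens_def)

lemma borel_measurable_gdens [measurable (raw)]:
  assumes [measurable]: "f \<in> borel_measurable M" "g \<in> borel_measurable M"
  shows "(\<lambda>x. gdens B a (f x) (g x)) \<in> borel_measurable M"
proof -
  have [measurable]: "(*v) B \<in> borel_measurable borel"
    by (intro borel_measurable_continuous_onI linear_continuous_on matrix_vector_mul_bounded_linear)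
  show ?thesis unfolding gdens_def by measurable
qed

lemma sets_gmeas [simp, measurable_cong]: "sets (gmeas B a m) = sets borel"
  and space_gmeas [simp]: "space (gmeas B a m) = UNIV"
  by (simp_all add: gmeas_def)

lemma nn_integral_gmeas:
  "h \<in> borel_measurable borel \<Longrightarrow> (\<integral>\<^sup>+x. h x \<partial>gmeas B a m) = (\<integral>\<^sup>+x. ennreal (gdens B a m x) * h x \<partial>lborel)"
  unfolding gmeas_def by (subst nn_integral_density) auto

lemma nn_integral_normal_density:
  "\<sigma> > 0 \<Longrightarrow> (\<integral>\<^sup>+x. normal_density \<mu> \<sigma> x \<partial>lborel) = 1"
  by (subst nn_integral_eq_integral) auto

text \<open>Shift by \<open>m\<close> and substitute \<open>u = B *v x\<close>: the factor
  \<open>\<bar>det B\<bar>\<close> is the Jacobian, and what remains is a product over the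
  coordinates of one-dimensional normal densities with variance \<open>a\<close>.\<close>

lemma nn_integral_gdens:
  fixes m :: "real^'d"
  assumes a: "a > 0" and B: "det B \<noteq> 0"
  shows "(\<integral>\<^sup>+x. gdens B a m x \<partial>lborel) = 1"
proof -
  define h :: "real^'d \<Rightarrow> ennreal" where "h u = (\<Prod>b\<in>Basis. normal_density 0 (sqrt a) (u \<bullet> b))" for u
  have [measurable]: "h \<in> borel_measurable borel" unfolding h_def by measurable
  have gh: "ennreal (gdens B a m (m + 1 *\<^sub>R x)) = ennreal \<bar>det B\<bar> * h (B *v x)" for x
  proof -
    have "(\<Prod>b\<in>Basis. normal_density 0 (sqrt a) (u \<bullet> b))
        = exp (- (norm u)\<^sup>2 / (2 * a)) / sqrt (2 * pi * a) ^ CARD('d)" for u :: "real^'d"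
    proof -
      have "(\<Prod>b\<in>Basis. exp (- (u \<bullet> b)\<^sup>2 / (2 * a))) = exp (\<Sum>b\<in>Basis. - (u \<bullet> b)\<^sup>2 / (2 * a))"
        by (simp add: exp_sum)
      also have "(\<Sum>b\<in>Basis. - (u \<bullet> b)\<^sup>2 / (2 * a)) = - (norm u)\<^sup>2 / (2 * a)"
        by (subst power2_norm_eq_inner, subst euclidean_inner)
          (simp add: sum_negf sum_divide_distrib power2_eq_square)
      finally show ?thesis
        using a by (simp add: normal_density_def prod_dividef prod.distrib power_one_over)
    qed
    then show ?thesis
      unfolding h_def by (simp add: gdens_def prod_ennreal ennreal_mult' flip: ennreal_mult')
  qed
  have inj: "inj ((*v) B)" using B by (simp add: inj_matrix_vector_mult invertible_det_nz)
  have "(\<integral>\<^sup>+x. gdens B a m x \<partial>lborel) = (\<integral>\<^sup>+x. gdens B a m (m + 1 *\<^sub>R x) \<partial>lborel)"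
    using nn_integral_lborel_affine[of "\<lambda>x. ennreal (gdens B a m x)" 1 m] by simp
  also have "\<dots> = ennreal \<bar>det B\<bar> * (\<integral>\<^sup>+x. h (B *v x) \<partial>lborel)"
  proof -
    have [measurable]: "(*v) B \<in> borel_measurable borel"
      by (intro borel_measurable_continuous_onI linear_continuous_on matrix_vector_mul_bounded_linear)
    show ?thesis unfolding gh by (simp add: nn_integral_cmult)
  qed
  also have "\<dots> = (\<integral>\<^sup>+x. h x \<partial>lborel)"
    using nn_integral_lborel_linear[OF matrix_vector_mul_linear inj, of h] by simp
  also have "\<dots> = 1"
    unfolding h_def using a
    by (subst prod_ennreal[symmetric], simp, subst nn_integral_lborel_prod)
      (auto simp: nn_integral_normal_density)
  finally show ?thesis .
qed

lemma prob_space_gmeas: "a > 0 \<Longrightarrow> det B \<noteq> 0 \<Longrightarrow> prob_space (gmeas B a m)"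
  by (rule prob_spaceI) (simp add: gmeas_def emeasure_density nn_integral_gdens)

text \<open>Completing the square.\<close>
lemma gdens_mult_gdens:
  fixes x y :: "real^'d"
  assumes a: "a > 0" and b: "b > 0"
  shows "gdens B a m (x - y) * gdens B b k y
    = gdens B (a + b) (m + k) x * gdens B (a * b / (a + b)) (k + (b / (a + b)) *\<^sub>R (x - m - k)) y"
proof -
  define u v where "u = B *v (x - m - k)" and "v = B *v (y - k)"
  have ab: "a + b \<noteq> 0" "a + b > 0" using a b by auto
  have uv: "B *v (x - y - m) = u - v" "B *v (x - (m + k)) = u"
      "B *v (y - (k + (b / (a + b)) *\<^sub>R (x - m - k))) = v - (b / (a + b)) *\<^sub>R u"
    by (simp_all add: u_def v_def matrix_vector_mult_diff_distrib matrix_vector_right_distrib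
        matrix_vector_mult_scaleR algebra_simps)
  have e: "- (norm (u - v))\<^sup>2 / (2 * a) + - (norm v)\<^sup>2 / (2 * b)
     = - (norm u)\<^sup>2 / (2 * (a + b)) + - (norm (v - (b / (a + b)) *\<^sub>R u))\<^sup>2 / (2 * (a * b / (a + b)))"
  proof -
    \<comment> \<open>All norms are quadratic in \<open>u\<close> and \<open>v\<close>, so the claim
      becomes a linear identity in the three scalars \<open>p\<close>, \<open>q\<close>,
      \<open>r\<close>.\<close>
    define p q r where "p = u \<bullet> u" and "q = u \<bullet> v" and "r = v \<bullet> v"
    have n: "(norm (u - v))\<^sup>2 = p - 2 * q + r" "(norm u)\<^sup>2 = p" "(norm v)\<^sup>2 = r"
        "(norm (v - (b / (a + b)) *\<^sub>R u))\<^sup>2 = r - 2 * (b / (a + b)) * q + (b / (a + b))\<^sup>2 * p"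
      unfolding power2_norm_eq_inner
      by (simp_all add: p_def q_def r_def inner_diff_left inner_diff_right
          inner_commute power2_eq_square)
    \<comment> \<open>The letter \<open>c\<close> stands for \<open>a + b\<close>; keeping it atomic
      prevents the sum from being multiplied out.\<close>
    have "(r - 2 * (b / c) * q + (b / c)\<^sup>2 * p) / (2 * (a * b / c))
        = c * r / (2 * a * b) - q / a + b * p / (2 * a * c)" if "c \<noteq> 0" for c
      using a b that by (simp add: field_simps power2_eq_square)
    note this[OF ab(1)]
    moreover have "(a + b) * r / (2 * a * b) = r / (2 * a) + r / (2 * b)"
      using a b by (simp add: field_simps)
    moreover have "p / (2 * (a + b)) + b * p / (2 * a * (a + b)) = p / (2 * a)"
      using a b ab by (simp add: divide_simps) (simp add: algebra_simps)
    moreover have "(p - 2 * q + r) / (2 * a) = p / (2 * a) - q / a + r / (2 * a)"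
      by (simp add: diff_divide_distrib add_divide_distrib)
    ultimately show ?thesis unfolding n minus_divide_left[symmetric] by linarith
  qed
  \<comment> \<open>The two pairs of variances have the same product, so the normalising constants
    agree.\<close>
  have "sqrt (2 * pi * a) * sqrt (2 * pi * b) = sqrt (2 * pi * (a + b)) * sqrt (2 * pi * (a * b / (a + b)))"
    using a b ab by (simp flip: real_sqrt_mult add: field_simps)
  then have c: "sqrt (2 * pi * a) ^ CARD('d) * sqrt (2 * pi * b) ^ CARD('d)
      = sqrt (2 * pi * (a + b)) ^ CARD('d) * sqrt (2 * pi * (a * b / (a + b))) ^ CARD('d)"
    by (metis power_mult_distrib)
  have "gdens B a m (x - y) * gdens B b k y = (det B)\<^sup>2 *
      exp (- (norm (u - v))\<^sup>2 / (2 * a) + - (norm v)\<^sup>2 / (2 * b)) /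
      (sqrt (2 * pi * a) ^ CARD('d) * sqrt (2 * pi * b) ^ CARD('d))"
    unfolding gdens_def uv exp_add v_def[symmetric] by (simp add: power2_eq_square)
  also have "\<dots> = gdens B (a + b) (m + k) x * gdens B (a * b / (a + b)) (k + (b / (a + b)) *\<^sub>R (x - m - k)) y"
    unfolding e c exp_add unfolding gdens_def uv by (simp add: power2_eq_square)
  finally show ?thesis .
qed

text \<open>Convolution of two normal laws. After completing the square, \<open>s\<close> occurs
  only in a normal density centred at a point depending on \<open>x\<close>, and once the order of
  integration is exchanged that density integrates to one.\<close>

lemma nn_integral_gmeas_add:
  fixes h :: "real^'d \<Rightarrow> ennreal"
  assumes a: "a > 0" and b: "b > 0" and B: "det B \<noteq> 0" and h[measurable]: "h \<in> borel_measurable borel"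
  shows "(\<integral>\<^sup>+s. \<integral>\<^sup>+y. h (y + s) \<partial>gmeas B a m \<partial>gmeas B b k) = (\<integral>\<^sup>+x. h x \<partial>gmeas B (a + b) (m + k))"
proof -
  have "(\<integral>\<^sup>+s. \<integral>\<^sup>+y. h (y + s) \<partial>gmeas B a m \<partial>gmeas B b k)
      = (\<integral>\<^sup>+s. gdens B b k s * (\<integral>\<^sup>+y. gdens B a m y * h (y + s) \<partial>lborel) \<partial>lborel)"
    by (simp add: nn_integral_gmeas)
  also have "\<dots> = (\<integral>\<^sup>+s. gdens B b k s * (\<integral>\<^sup>+x. gdens B a m (x - s) * h x \<partial>lborel) \<partial>lborel)"
  proof -
    have "(\<integral>\<^sup>+y. gdens B a m y * h (y + s) \<partial>lborel) = (\<integral>\<^sup>+x. gdens B a m (x - s) * h x \<partial>lborel)" for s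
      using nn_integral_lborel_affine[of "\<lambda>y. gdens B a m y * h (y + s)" 1 "-s"] by simp
    then show ?thesis by simp
  qed
  also have "\<dots> = (\<integral>\<^sup>+s. \<integral>\<^sup>+x. gdens B (a + b) (m + k) x * h x
      * gdens B (a * b / (a + b)) (k + (b / (a + b)) *\<^sub>R (x - m - k)) s \<partial>lborel \<partial>lborel)"
  proof (rule nn_integral_cong)
    fix s :: "real^'d"
    have "ennreal (gdens B b k s) * (ennreal (gdens B a m (x - s)) * h x)
      = ennreal (gdens B (a + b) (m + k) x) * h x
      * ennreal (gdens B (a * b / (a + b)) (k + (b / (a + b)) *\<^sub>R (x - m - k)) s)" for x
    proof -
      have "ennreal (gdens B b k s) * (ennreal (gdens B a m (x - s)) * h x)
        = ennreal (gdens B a m (x - s) * gdens B b k s) * h x"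
        using a b by (simp add: ennreal_mult mult_ac)
      also have "\<dots> = ennreal (gdens B (a + b) (m + k) x
          * gdens B (a * b / (a + b)) (k + (b / (a + b)) *\<^sub>R (x - m - k)) s) * h x"
        by (simp only: gdens_mult_gdens[OF a b])
      finally show ?thesis using a b by (simp add: ennreal_mult mult_ac)
    qed
    then show "gdens B b k s * (\<integral>\<^sup>+x. gdens B a m (x - s) * h x \<partial>lborel) =
      (\<integral>\<^sup>+x. gdens B (a + b) (m + k) x * h x
      * gdens B (a * b / (a + b)) (k + (b / (a + b)) *\<^sub>R (x - m - k)) s \<partial>lborel)"
      by (simp flip: nn_integral_cmult)
  qed
  also have "\<dots> = (\<integral>\<^sup>+x. \<integral>\<^sup>+s. gdens B (a + b) (m + k) x * h x
      * gdens B (a * b / (a + b)) (k + (b / (a + b)) *\<^sub>R (x - m - k)) s \<partial>lborel \<partial>lborel)"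
    by (rule lborel_pair.Fubini') simp
  also have "\<dots> = (\<integral>\<^sup>+x. gdens B (a + b) (m + k) x * h x \<partial>lborel)"
    using a b B by (simp add: nn_integral_cmult nn_integral_gdens)
  also have "\<dots> = (\<integral>\<^sup>+x. h x \<partial>gmeas B (a + b) (m + k))"
    by (simp add: nn_integral_gmeas)
  finally show ?thesis .
qed

text \<open>One summand is split off and integrated first; \<open>h\<close> is arbitrary in the
  induction because the hypothesis is applied to the resulting function of the remaining sum. The
  induction starts at a singleton, as an empty sum is a point mass and has no density.\<close>

lemma nn_integral_PiM_gmeas_sum:
  fixes h :: "real^'d \<Rightarrow> ennreal"
  assumes "finite I" "I \<noteq> {}" and a: "a > 0" and B: "det B \<noteq> 0"
    and h: "h \<in> borel_measurable borel"
  shows "(\<integral>\<^sup>+x. h (\<Sum>i\<in>I. x i) \<partial>PiM I (\<lambda>_. gmeas B a m))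
    = (\<integral>\<^sup>+x. h x \<partial>gmeas B (real (card I) * a) (real (card I) *\<^sub>R m))"
  using assms(1,2) h
proof (induction arbitrary: h rule: finite_ne_induct)
  case (singleton i)
  interpret product_sigma_finite "\<lambda>_. gmeas B a m"
    by (rule product_sigma_finite_prob) (rule prob_space_gmeas[OF a B])
  show ?case
    using product_nn_integral_singleton[of h i] singleton by (simp cong: measurable_cong_sets)
next
  case (insert i I)
  interpret product_sigma_finite "\<lambda>_. gmeas B a m"
    by (rule product_sigma_finite_prob) (rule prob_space_gmeas[OF a B])
  interpret M: prob_space "gmeas B a m" by (rule prob_space_gmeas[OF a B])
  have [measurable]: "h \<in> borel_measurable borel" by fact
  have c: "real (card I) * a > 0" using insert a by (simp add: card_gt_0_iff)
  have "(\<integral>\<^sup>+x. h (\<Sum>i\<in>insert i I. x i) \<partial>PiM (insert i I) (\<lambda>_. gmeas B a m))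
     = (\<integral>\<^sup>+x. \<integral>\<^sup>+y. h (\<Sum>j\<in>insert i I. (x(i := y)) j) \<partial>gmeas B a m \<partial>PiM I (\<lambda>_. gmeas B a m))"
    using insert by (subst product_nn_integral_insert) (auto)
  also have "\<dots> = (\<integral>\<^sup>+x. \<integral>\<^sup>+y. h (y + (\<Sum>j\<in>I. x j)) \<partial>gmeas B a m \<partial>PiM I (\<lambda>_. gmeas B a m))"
  proof -
    have "(\<Sum>j\<in>I. (x(i := y)) j) = (\<Sum>j\<in>I. x j)" for x :: "_ \<Rightarrow> real^'d" and y
      using insert by (intro sum.cong) auto
    then have "(\<Sum>j\<in>insert i I. (x(i := y)) j) = y + (\<Sum>j\<in>I. x j)" for x :: "_ \<Rightarrow> real^'d" and y
      using insert by simp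
    then show ?thesis by simp
  qed
  also have "\<dots> = (\<integral>\<^sup>+s. \<integral>\<^sup>+y. h (y + s) \<partial>gmeas B a m \<partial>gmeas B (real (card I) * a) (real (card I) *\<^sub>R m))"
    by (rule insert.IH) measurable
  also have "\<dots> = (\<integral>\<^sup>+x. h x \<partial>gmeas B (a + real (card I) * a) (m + real (card I) *\<^sub>R m))"
    by (rule nn_integral_gmeas_add[OF a c B]) simp
  also have "a + real (card I) * a = real (card (insert i I)) * a"
    using insert by (simp add: algebra_simps)
  also have "m + real (card I) *\<^sub>R m = real (card (insert i I)) *\<^sub>R m"
    using insert by (simp add: algebra_simps)
  finally show ?case .
qed

text \<open>The Jacobian \<open>c ^ CARD('d)\<close> of the substitution cancels against the
  normalising constant for variance \<open>c\<^sup>2 * a\<close>.\<close>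

lemma nn_integral_gmeas_affine:
  fixes h :: "real^'d \<Rightarrow> ennreal"
  assumes c: "c > 0" and a: "a > 0" and [measurable]: "h \<in> borel_measurable borel"
  shows "(\<integral>\<^sup>+x. h (c *\<^sub>R (t + x)) \<partial>gmeas B a m) = (\<integral>\<^sup>+x. h x \<partial>gmeas B (c\<^sup>2 * a) (c *\<^sub>R (t + m)))"
proof -
  have g: "c ^ CARD('d) * gdens B (c\<^sup>2 * a) (c *\<^sub>R (t + m)) (c *\<^sub>R t + c *\<^sub>R x) = gdens B a m x" for x
  proof -
    have "c *\<^sub>R t + c *\<^sub>R x - c *\<^sub>R (t + m) = c *\<^sub>R (x - m)" by (simp add: algebra_simps)
    then have "(norm (B *v (c *\<^sub>R t + c *\<^sub>R x - c *\<^sub>R (t + m))))\<^sup>2 = c\<^sup>2 * (norm (B *v (x - m)))\<^sup>2"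
      by (simp only: matrix_vector_mult_scaleR norm_scaleR power_mult_distrib power2_abs)
    moreover have "sqrt (2 * pi * (c\<^sup>2 * a)) ^ CARD('d) = c ^ CARD('d) * sqrt (2 * pi * a) ^ CARD('d)"
      using c by (simp add: real_sqrt_mult power_mult_distrib)
    ultimately show ?thesis using c a by (simp add: gdens_def)
  qed
  have "(\<integral>\<^sup>+x. h x \<partial>gmeas B (c\<^sup>2 * a) (c *\<^sub>R (t + m)))
    = ennreal (c ^ CARD('d)) * (\<integral>\<^sup>+x. gdens B (c\<^sup>2 * a) (c *\<^sub>R (t + m)) (c *\<^sub>R t + c *\<^sub>R x) * h (c *\<^sub>R t + c *\<^sub>R x) \<partial>lborel)"
    using c by (simp add: nn_integral_gmeas,
        subst nn_integral_lborel_affine[where t="c *\<^sub>R t" and c=c]) auto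
  also have "\<dots> = (\<integral>\<^sup>+x. gdens B a m x * h (c *\<^sub>R (t + x)) \<partial>lborel)"
    using c a by (subst nn_integral_cmult[symmetric])
      (auto simp: mult.assoc[symmetric] ennreal_mult'[symmetric] g[unfolded scaleR_add_right] scaleR_add_right)
  finally show ?thesis by (simp add: nn_integral_gmeas)
qed

lemma distr_mean_gmeas:
  fixes mu :: "real^'d"
  assumes I: "finite I" "I \<noteq> {}" and a: "a > 0" and B: "det B \<noteq> 0"
  shows "distr (PiM I (\<lambda>_. gmeas B a mu)) lborel (\<lambda>x. (1 / card I) *\<^sub>R (\<Sum>i\<in>I. x i))
    = gmeas B (a / card I) mu"
proof (rule distr_eqI_nn_integral)
  have c: "real (card I) > 0" using I by (simp add: card_gt_0_iff)
  fix h :: "real^'d \<Rightarrow> ennreal" assume "h \<in> borel_measurable lborel"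
  then have h[measurable]: "h \<in> borel_measurable borel" by simp
  have "(\<integral>\<^sup>+x. h ((1 / card I) *\<^sub>R (\<Sum>i\<in>I. x i)) \<partial>PiM I (\<lambda>_. gmeas B a mu))
    = (\<integral>\<^sup>+x. h ((1 / card I) *\<^sub>R (0 + x)) \<partial>gmeas B (card I * a) (real (card I) *\<^sub>R mu))"
    using nn_integral_PiM_gmeas_sum[OF I a B, of "\<lambda>x. h ((1 / card I) *\<^sub>R x)" mu] by simp
  also have "\<dots> = (\<integral>\<^sup>+x. h x \<partial>gmeas B ((1 / card I)\<^sup>2 * (card I * a)) ((1 / card I) *\<^sub>R (0 + real (card I) *\<^sub>R mu)))"
    using c a by (intro nn_integral_gmeas_affine) auto
  finally show "(\<integral>\<^sup>+x. h ((1 / card I) *\<^sub>R (\<Sum>i\<in>I. x i)) \<partial>PiM I (\<lambda>_. gmeas B a mu))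
      = (\<integral>\<^sup>+x. h x \<partial>gmeas B (a / card I) mu)"
    using c by (simp add: power2_eq_square)
qed simp_all

text \<open>Coordinate \<open>J\<close> no longer enters and integrates to one, while the other
  \<open>card I - 1\<close> points contribute a normal sum shifted by \<open>z\<close>. Hence the
  law is the same for every replaced index.\<close>

lemma distr_mean_replaced_gmeas:
  fixes mu z :: "real^'d"
  assumes I: "finite I" "card I \<ge> 2" and J: "J \<in> I" and a: "a > 0" and B: "det B \<noteq> 0"
  shows "distr (PiM I (\<lambda>_. gmeas B a mu)) lborel (\<lambda>x. (1 / card I) *\<^sub>R (\<Sum>i\<in>I. if i = J then z else x i))
    = gmeas B ((real (card I) - 1) * a / (real (card I))\<^sup>2) ((1 / card I) *\<^sub>R (z + (real (card I) - 1) *\<^sub>R mu))"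
proof (rule distr_eqI_nn_integral)
  interpret product_sigma_finite "\<lambda>_. gmeas B a mu"
    by (rule product_sigma_finite_prob) (rule prob_space_gmeas[OF a B])
  interpret M: prob_space "gmeas B a mu" by (rule prob_space_gmeas[OF a B])
  have c: "real (card I) > 0" using I by simp
  have cJ: "real (card (I - {J})) = real (card I) - 1" using I J by (simp add: of_nat_diff)
  \<comment> \<open>With a single point the mean would be the constant \<open>z\<close>; this is
    where \<open>card I \<ge> 2\<close> enters.\<close>
  have "I - {J} \<noteq> {}" using cJ I(2) by force
  fix h :: "real^'d \<Rightarrow> ennreal" assume "h \<in> borel_measurable lborel"
  then have h[measurable]: "h \<in> borel_measurable borel" by simp
  have II: "insert J (I - {J}) = I" using J by auto
  have s: "(\<Sum>i\<in>I. if i = J then z else x i) = z + (\<Sum>i\<in>I - {J}. x i)" for x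
    by (subst sum.remove[OF I(1) J]) (auto intro!: sum.cong)
  have "(\<integral>\<^sup>+x. h ((1 / card I) *\<^sub>R (z + (\<Sum>i\<in>I - {J}. x i))) \<partial>PiM (insert J (I - {J})) (\<lambda>_. gmeas B a mu))
    = (\<integral>\<^sup>+x. \<integral>\<^sup>+y. h ((1 / card I) *\<^sub>R (z + (\<Sum>i\<in>I - {J}. (x(J := y)) i))) \<partial>gmeas B a mu \<partial>PiM (I - {J}) (\<lambda>_. gmeas B a mu))"
    using I by (subst product_nn_integral_insert) auto
  also have "\<dots> = (\<integral>\<^sup>+x. h ((1 / card I) *\<^sub>R (z + (\<Sum>i\<in>I - {J}. x i))) \<partial>PiM (I - {J}) (\<lambda>_. gmeas B a mu))"
  proof -
    have "(\<Sum>i\<in>I - {J}. (x(J := y)) i) = (\<Sum>i\<in>I - {J}. x i)" for x :: "_ \<Rightarrow> real^'d" and y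
      by (intro sum.cong) auto
    then show ?thesis using M.emeasure_space_1 by simp
  qed
  also have "\<dots> = (\<integral>\<^sup>+x. h ((1 / card I) *\<^sub>R (z + x)) \<partial>gmeas B (card (I - {J}) * a) (real (card (I - {J})) *\<^sub>R mu))"
    using I by (intro nn_integral_PiM_gmeas_sum[OF _ \<open>I - {J} \<noteq> {}\<close> a B]) auto
  also have "\<dots> = (\<integral>\<^sup>+x. h x \<partial>gmeas B ((1 / card I)\<^sup>2 * (card (I - {J}) * a)) ((1 / card I) *\<^sub>R (z + real (card (I - {J})) *\<^sub>R mu)))"
    using c a I cJ by (intro nn_integral_gmeas_affine) auto
  also have "(1 / card I)\<^sup>2 * (card (I - {J}) * a) = (real (card I) - 1) * a / (real (card I))\<^sup>2"
    unfolding cJ by (simp add: power_one_over)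
  finally show "(\<integral>\<^sup>+x. h ((1 / card I) *\<^sub>R (\<Sum>i\<in>I. if i = J then z else x i)) \<partial>PiM I (\<lambda>_. gmeas B a mu))
      = (\<integral>\<^sup>+x. h x \<partial>gmeas B ((real (card I) - 1) * a / (real (card I))\<^sup>2) ((1 / card I) *\<^sub>R (z + (real (card I) - 1) *\<^sub>R mu)))"
    unfolding II cJ s by simp
qed simp_all

section \<open>Cumulative means and batch means\<close>

text \<open>Weighted increments of the cumulative means. On extensional sequences over
  \<open>{1..T}\<close> this inverts \<open>running_means\<close> from both sides.\<close>

definition batch_mean :: "(nat \<Rightarrow> real^'d) \<Rightarrow> nat \<Rightarrow> real^'d" where
  "batch_mean y t = real t *\<^sub>R mu_hat y t - (real t - 1) *\<^sub>R mu_hat y (t - 1)"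

definition running_means :: "nat \<Rightarrow> (nat \<Rightarrow> real^'d) \<Rightarrow> (nat \<Rightarrow> real^'d)" where
  "running_means T w = (\<lambda>t\<in>{1..T}. (1 / real t) *\<^sub>R (\<Sum>j=1..t. w j))"

lemma N_tau_eq_batch_mean: "N_tau tau mu y = batch_mean y tau - mu"
  by (simp add: N_tau_def batch_mean_def)

text \<open>Averaging within batches first and across batches afterwards shows that the data enter
  only through the batch means.\<close>

lemma cum_means_eq_running_means:
  "cum_means T n X = running_means T (\<lambda>t\<in>{1..T}. (1 / real n) *\<^sub>R (\<Sum>k=1..n. X (t, k)))"
  unfolding cum_means_def running_means_def
proof (rule restrict_ext)
  fix t assume t: "t \<in> {1..T}"
  have "(\<Sum>j=1..t. (\<lambda>t\<in>{1..T}. (1 / real n) *\<^sub>R (\<Sum>k=1..n. X (t, k))) j)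
     = (\<Sum>j=1..t. (1 / real n) *\<^sub>R (\<Sum>k=1..n. X (j, k)))"
    using t by (intro sum.cong) auto
  also have "\<dots> = (1 / real n) *\<^sub>R (\<Sum>j=1..t. \<Sum>k=1..n. X (j, k))"
    by (simp only: scaleR_sum_right)
  finally show "(1 / (real n * real t)) *\<^sub>R (\<Sum>j=1..t. \<Sum>k=1..n. X (j, k))
     = (1 / real t) *\<^sub>R (\<Sum>j=1..t. (\<lambda>t\<in>{1..T}. (1 / real n) *\<^sub>R (\<Sum>k=1..n. X (t, k))) j)"
    by (simp add: mult.commute)
qed

text \<open>The increments telescope, and \<open>mu_hat y 0 = 0\<close> removes the lower
  end.\<close>

lemma sum_batch_mean: "(\<Sum>j=1..t. batch_mean y j) = real t *\<^sub>R mu_hat y t"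
  by (induction t) (auto simp: batch_mean_def)

lemma running_means_batch_mean:
  assumes "y \<in> extensional {1..T}"
  shows "running_means T (\<lambda>t\<in>{1..T}. batch_mean y t) = y"
proof
  fix t
  show "running_means T (\<lambda>t\<in>{1..T}. batch_mean y t) t = y t"
  proof (cases "t \<in> {1..T}")
    case True
    then have "(\<Sum>j=1..t. (\<lambda>t\<in>{1..T}. batch_mean y t) j) = (\<Sum>j=1..t. batch_mean y j)"
      by (intro sum.cong) auto
    with True show ?thesis by (simp add: running_means_def sum_batch_mean mu_hat_def del: One_nat_def)
  qed (use assms in \<open>auto simp: running_means_def extensional_def\<close>)
qed

lemma batch_mean_running_means:
  assumes "t \<in> {1..T}"
  shows "batch_mean (running_means T w) t = w t"
proof -
  \<comment> \<open>The case \<open>s = 0\<close> is included, where \<open>mu_hat\<close> and the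
    empty sum both vanish; it serves as the predecessor of \<open>t = 1\<close>.\<close>
  have *: "real s *\<^sub>R mu_hat (running_means T w) s = (\<Sum>j=1..s. w j)" if "s \<le> T" for s
    using that by (auto simp: mu_hat_def running_means_def)
  obtain s where s: "t = Suc s" using assms by (cases t) auto
  then have "batch_mean (running_means T w) t = (\<Sum>j=1..Suc s. w j) - (\<Sum>j=1..s. w j)"
    using assms *[of t] *[of s] by (simp add: batch_mean_def)
  then show ?thesis using s by simp
qed

section \<open>Measurability and null sets for the passage between cumulative means and batch
  means\<close>

lemma measurable_mu_hat [measurable]:
  "t \<le> T \<Longrightarrow> (\<lambda>y. mu_hat y t) \<in> PiM {1..T} (\<lambda>_. lborel) \<rightarrow>\<^sub>M borel"
  by (cases "t = 0") (auto simp: mu_hat_def intro!: measurable_compose[OF measurable_component_singleton, of _ _ _ "\<lambda>x. x"])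

lemma measurable_batch_mean [measurable]:
  "t \<le> T \<Longrightarrow> (\<lambda>y. batch_mean y t) \<in> PiM {1..T} (\<lambda>_. lborel) \<rightarrow>\<^sub>M borel"
  unfolding batch_mean_def by measurable

lemma measurable_running_means [measurable]:
  "running_means T \<in> PiM {1..T} (\<lambda>_. lborel) \<rightarrow>\<^sub>M PiM {1..T} (\<lambda>_. lborel)"
proof -
  have "(\<lambda>w. (1 / real t) *\<^sub>R (\<Sum>j=1..t. w j)) \<in> PiM {1..T} (\<lambda>_. lborel) \<rightarrow>\<^sub>M lborel"
    if "t \<in> {1..T}" for t
  proof -
    have [measurable]: "(\<lambda>w. w j) \<in> PiM {1..T} (\<lambda>_. lborel) \<rightarrow>\<^sub>M borel" if "j \<in> {1..t}" for j
      using that \<open>t \<in> {1..T}\<close> measurable_component_singleton[of j "{1..T}" "\<lambda>_. lborel"] by auto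
    show ?thesis by (simp del: One_nat_def)
  qed
  then show ?thesis unfolding running_means_def by (rule measurable_restrict)
qed

text \<open>The batch means are a triangular linear function of the cumulative means with diagonal
  entries \<open>t\<close>, each acting on \<open>CARD('d)\<close> coordinates; hence the constant
  Jacobian. The induction integrates out the last coordinate, which occurs in the last batch mean
  only.\<close>

lemma nn_integral_batch_mean:
  fixes h :: "(nat \<Rightarrow> real^'d) \<Rightarrow> ennreal"
  assumes "h \<in> borel_measurable (PiM {1..T} (\<lambda>_. lborel))"
  shows "(\<integral>\<^sup>+w. h w \<partial>PiM {1..T} (\<lambda>_. lborel))
    = ennreal (\<Prod>t=1..T. real t ^ CARD('d)) * (\<integral>\<^sup>+y. h (\<lambda>t\<in>{1..T}. batch_mean y t) \<partial>PiM {1..T} (\<lambda>_. lborel))"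
  using assms
proof (induction T arbitrary: h)
  case 0
  show ?case by (simp add: PiM_empty restrict_def nn_integral_count_space_finite cong: if_cong)
next
  case (Suc T)
  interpret product_sigma_finite "\<lambda>_::nat. lborel :: (real^'d) measure" ..
  interpret sigma_finite_measure "lborel :: (real^'d) measure" ..
  let ?P = "\<lambda>T. PiM {1..T} (\<lambda>_::nat. lborel :: (real^'d) measure)"
  let ?K = "\<lambda>T y. \<lambda>t\<in>{1..T}. batch_mean y t"
  have ins: "{1..Suc T} = insert (Suc T) {1..T}" by auto
  have h[measurable]: "h \<in> borel_measurable (?P (Suc T))" by fact
  have hi[measurable]: "h \<in> borel_measurable (PiM (insert (Suc T) {1..T}) (\<lambda>_. lborel))"
    using h unfolding ins .
  have K: "?K T \<in> ?P T \<rightarrow>\<^sub>M ?P T" for T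
    by (rule measurable_restrict) (simp del: One_nat_def)
  \<comment> \<open>Changing coordinate \<open>Suc T\<close> keeps the earlier batch means and makes
    the last one an affine function of \<open>y\<close> with factor \<open>Suc T\<close>, ready for
    the affine substitution below.\<close>
  have upd: "?K (Suc T) (x(Suc T := y)) = (?K T x)(Suc T := - (real T *\<^sub>R mu_hat x T) + real (Suc T) *\<^sub>R y)"
    for x :: "nat \<Rightarrow> real^'d" and y
  proof
    fix t
    consider "t = Suc T" | "t \<in> {1..T}" | "t \<notin> {1..Suc T}" by fastforce
    then show "?K (Suc T) (x(Suc T := y)) t = ((?K T x)(Suc T := - (real T *\<^sub>R mu_hat x T) + real (Suc T) *\<^sub>R y)) t"
      by cases (auto simp: batch_mean_def mu_hat_def)
  qed
  have H: "(\<lambda>x. \<integral>\<^sup>+y. h (x(Suc T := y)) \<partial>lborel) \<in> borel_measurable (?P T)"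
    by measurable
  have "(\<integral>\<^sup>+w. h w \<partial>?P (Suc T)) = (\<integral>\<^sup>+x. \<integral>\<^sup>+y. h (x(Suc T := y)) \<partial>lborel \<partial>?P T)"
    unfolding ins using hi by (intro product_nn_integral_insert) auto
  \<comment> \<open>The induction hypothesis is used for the function obtained by integrating over
    the last coordinate.\<close>
  also have "\<dots> = ennreal (\<Prod>t=1..T. real t ^ CARD('d)) * (\<integral>\<^sup>+x. \<integral>\<^sup>+y. h ((?K T x)(Suc T := y)) \<partial>lborel \<partial>?P T)"
    by (rule Suc.IH[OF H])
  also have "(\<integral>\<^sup>+x. \<integral>\<^sup>+y. h ((?K T x)(Suc T := y)) \<partial>lborel \<partial>?P T)
     = (\<integral>\<^sup>+x. ennreal (real (Suc T) ^ CARD('d)) * (\<integral>\<^sup>+y. h (?K (Suc T) (x(Suc T := y))) \<partial>lborel) \<partial>?P T)"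
  proof (rule nn_integral_cong)
    fix x assume x: "x \<in> space (?P T)"
    have "(\<lambda>y. (?K T x)(Suc T := y)) \<in> lborel \<rightarrow>\<^sub>M PiM (insert (Suc T) {1..T}) (\<lambda>_. lborel)"
      using measurable_space[OF K x] by (intro measurable_fun_upd[where J="{1..T}"]) auto
    then have "(\<lambda>y. h ((?K T x)(Suc T := y))) \<in> borel_measurable borel"
      using measurable_compose[OF _ hi] by (simp cong: measurable_cong_sets)
    from nn_integral_lborel_affine[OF this, of "real (Suc T)" "- (real T *\<^sub>R mu_hat x T)"]
    show "(\<integral>\<^sup>+y. h ((?K T x)(Suc T := y)) \<partial>lborel)
      = ennreal (real (Suc T) ^ CARD('d)) * (\<integral>\<^sup>+y. h (?K (Suc T) (x(Suc T := y))) \<partial>lborel)"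
      unfolding upd by simp
  qed
  also have "\<dots> = ennreal (real (Suc T) ^ CARD('d)) * (\<integral>\<^sup>+x. \<integral>\<^sup>+y. h (?K (Suc T) (x(Suc T := y))) \<partial>lborel \<partial>?P T)"
  proof (rule nn_integral_cmult)
    have "(\<lambda>y. h (?K (Suc T) y)) \<in> borel_measurable (PiM (insert (Suc T) {1..T}) (\<lambda>_. lborel))"
      using measurable_compose[OF K h] unfolding ins[symmetric] .
    then show "(\<lambda>x. \<integral>\<^sup>+y. h (?K (Suc T) (x(Suc T := y))) \<partial>lborel) \<in> borel_measurable (?P T)"
      by measurable
  qed
  also have "(\<integral>\<^sup>+x. \<integral>\<^sup>+y. h (?K (Suc T) (x(Suc T := y))) \<partial>lborel \<partial>?P T) = (\<integral>\<^sup>+y. h (?K (Suc T) y) \<partial>?P (Suc T))"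
  proof -
    have "(\<lambda>y. h (?K (Suc T) y)) \<in> borel_measurable (PiM (insert (Suc T) {1..T}) (\<lambda>_. lborel))"
      using measurable_compose[OF K h] unfolding ins[symmetric] .
    from product_nn_integral_insert[OF _ _ this] show ?thesis unfolding ins[symmetric] by simp
  qed
  finally have "(\<integral>\<^sup>+w. h w \<partial>?P (Suc T)) = ennreal (\<Prod>t=1..T. real t ^ CARD('d)) *
      ennreal (real (Suc T) ^ CARD('d)) * (\<integral>\<^sup>+y. h (?K (Suc T) y) \<partial>?P (Suc T))"
    by (simp only: mult.assoc)
  also have "ennreal (\<Prod>t=1..T. real t ^ CARD('d)) * ennreal (real (Suc T) ^ CARD('d))
      = ennreal (\<Prod>t=1..Suc T. real t ^ CARD('d))"
    by (simp add: prod_nonneg ennreal_mult)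
  finally show ?case .
qed

text \<open>The integral of the indicator of the exceptional set changes only by a positive
  constant, so null sets pull back to null sets.\<close>

lemma AE_batch_mean:
  assumes P[measurable]: "Measurable.pred (PiM {1..T} (\<lambda>_. lborel)) P"
    and "AE w in PiM {1..T} (\<lambda>_. lborel). P w"
  shows "AE y in PiM {1..T} (\<lambda>_. lborel :: (real^'d) measure). P (\<lambda>t\<in>{1..T}. batch_mean y t)"
proof -
  let ?P = "PiM {1..T} (\<lambda>_::nat. lborel :: (real^'d) measure)"
  let ?K = "\<lambda>y. \<lambda>t\<in>{1..T}. batch_mean y t"
  have [measurable]: "?K \<in> ?P \<rightarrow>\<^sub>M ?P"
    by (rule measurable_restrict) (simp del: One_nat_def)
  have ind: "(\<lambda>w. indicator {w \<in> space ?P. \<not> P w} w :: ennreal) \<in> borel_measurable ?P"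
    by measurable
  have "(\<integral>\<^sup>+w. indicator {w \<in> space ?P. \<not> P w} w \<partial>?P) = 0"
    using assms(2) by (subst nn_integral_0_iff_AE[OF ind]) (auto elim!: eventually_mono)
  then have "ennreal (\<Prod>t=1..T. real t ^ CARD('d)) * (\<integral>\<^sup>+y. indicator {w \<in> space ?P. \<not> P w} (?K y) \<partial>?P) = 0"
    using nn_integral_batch_mean[OF ind] by simp
  moreover have "(\<Prod>t=1..T. real t ^ CARD('d)) > 0"
    by (rule prod_pos) auto
  ultimately have "(\<integral>\<^sup>+y. indicator {w \<in> space ?P. \<not> P w} (?K y) \<partial>?P) = 0"
    by simp
  then have "AE y in ?P. (indicator {w \<in> space ?P. \<not> P w} (?K y) :: ennreal) = 0"
    by (subst (asm) nn_integral_0_iff_AE) (auto simp del: One_nat_def)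
  moreover have "AE y in ?P. ?K y \<in> space ?P"
    by (rule AE_I2) (auto simp: space_PiM)
  ultimately show ?thesis
    by eventually_elim (auto simp: indicator_def split: if_splits)
qed

section \<open>The likelihood ratio\<close>

definition log_LR :: "nat \<Rightarrow> real^'d \<Rightarrow> real^'d^'d \<Rightarrow> real^'d \<Rightarrow> real^'d \<Rightarrow> real" where
  "log_LR n mu S z N =
    - (real CARD('d) / 2) * ln ((real n - 1) / real n)
    - real n / (2 * (real n - 1)) * (N \<bullet> (matrix_inv S *v N))
    + real n / (real n - 1) * (N \<bullet> (matrix_inv S *v (z - mu)))
    - ((z - mu) \<bullet> (matrix_inv S *v (z - mu))) / (2 * (real n - 1))"

text \<open>Measured from \<open>mu\<close>, the mean with a replaced point is centred at (z -
  mu)/n, so in whitened coordinates its exponent is a multiple of the squared norm of u - v/n.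
  Expanding it gives the quadratic, mixed and constant terms, and the ratio (n - 1)/n of the
  variances gives the logarithm.\<close>

lemma gdens_replaced_mean:
  fixes S :: "real^'d^'d"
  assumes n: "n \<ge> 2" and B: "\<And>x y. x \<bullet> (matrix_inv S *v y) = (B *v x) \<bullet> (B *v y)"
  shows "gdens B ((real n - 1) / (real n)\<^sup>2) ((1 / real n) *\<^sub>R (z + (real n - 1) *\<^sub>R mu)) w
    = gdens B (1 / real n) mu w * exp (log_LR n mu S z (w - mu))"
proof -
  define N where "N = real n"
  have N: "N > 1" "N > 0" using n by (simp_all add: N_def)
  define u v where "u = B *v (w - mu)" and "v = B *v (z - mu)"
  have "w - (1 / N) *\<^sub>R (z + (N - 1) *\<^sub>R mu) = (w - mu) - (1 / N) *\<^sub>R (z - mu)"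
    using N by (simp add: algebra_simps diff_divide_distrib)
  then have Bw: "B *v (w - (1 / N) *\<^sub>R (z + (N - 1) *\<^sub>R mu)) = u - (1 / N) *\<^sub>R v"
    by (simp only: matrix_vector_mult_diff_distrib[of B "w - mu"] matrix_vector_mult_scaleR u_def v_def)
  have e: "- (norm (u - (1 / N) *\<^sub>R v))\<^sup>2 / (2 * ((N - 1) / N\<^sup>2))
    = - (norm u)\<^sup>2 / (2 * (1 / N)) + (- N / (2 * (N - 1)) * (u \<bullet> u) + N / (N - 1) * (u \<bullet> v) - (v \<bullet> v) / (2 * (N - 1)))"
  proof -
    define p q r where "p = u \<bullet> u" and "q = u \<bullet> v" and "r = v \<bullet> v"
    have 1: "(norm (u - (1 / N) *\<^sub>R v))\<^sup>2 = p - 2 * q / N + r / N\<^sup>2" "(norm u)\<^sup>2 = p"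
      unfolding power2_norm_eq_inner
      by (simp_all add: p_def q_def r_def inner_diff_left inner_diff_right inner_commute power2_eq_square)
    \<comment> \<open>Writing \<open>N = M + 1\<close> turns the denominator \<open>N - 1\<close>
      into a positive variable.\<close>
    obtain M where M: "N = M + 1" "M > 0" using N by (metis add.commute diff_add_cancel diff_gt_0_iff_gt)
    show ?thesis unfolding 1 p_def[symmetric] q_def[symmetric] r_def[symmetric] unfolding M(1)
      using M(2) by (simp add: divide_simps power2_eq_square) (simp add: algebra_simps)
  qed
  \<comment> \<open>The covariances differ by the scalar \<open>(N - 1) / N\<close>, whose square
    root enters once per dimension. It is written as an exponential so that it can join the
    exponent.\<close>
  have c: "sqrt (2 * pi * ((N - 1) / N\<^sup>2)) ^ CARD('d)
     = sqrt (2 * pi * (1 / N)) ^ CARD('d) / exp (- (real CARD('d) / 2) * ln ((N - 1) / N))"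
  proof -
    have r: "(N - 1) / N > 0" using N by simp
    have "exp (- (real CARD('d) / 2) * ln ((N - 1) / N)) = 1 / exp (real CARD('d) * (ln ((N - 1) / N) / 2))"
    proof -
      have "- (real CARD('d) / 2) * ln ((N - 1) / N) = - (real CARD('d) * (ln ((N - 1) / N) / 2))" by simp
      then show ?thesis by (simp only: exp_minus inverse_eq_divide)
    qed
    also have "exp (real CARD('d) * (ln ((N - 1) / N) / 2)) = exp (ln ((N - 1) / N) / 2) ^ CARD('d)"
      by (rule exp_of_nat_mult)
    also have "exp (ln ((N - 1) / N) / 2) = sqrt ((N - 1) / N)"
    proof -
      have "sqrt ((N - 1) / N) > 0" using r by (simp only: real_sqrt_gt_0_iff)
      then have "exp (ln (sqrt ((N - 1) / N))) = sqrt ((N - 1) / N)" by (rule exp_ln)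
      then show ?thesis using r by (simp only: ln_sqrt less_imp_le)
    qed
    finally have "exp (- (real CARD('d) / 2) * ln ((N - 1) / N)) = 1 / sqrt ((N - 1) / N) ^ CARD('d)" .
    moreover have "sqrt (2 * pi * ((N - 1) / N\<^sup>2)) = sqrt (2 * pi * (1 / N)) * sqrt ((N - 1) / N)"
      by (simp add: power2_eq_square flip: real_sqrt_mult)
    ultimately show ?thesis by (simp add: power_mult_distrib)
  qed
  have l: "log_LR n mu S z (w - mu) = - (real CARD('d) / 2) * ln ((N - 1) / N)
     + (- N / (2 * (N - 1)) * (u \<bullet> u) + N / (N - 1) * (u \<bullet> v) - (v \<bullet> v) / (2 * (N - 1)))"
    unfolding log_LR_def B N_def u_def v_def by simp
  show ?thesis
    unfolding l N_def[symmetric] gdens_def Bw e c u_def[symmetric] exp_add by simp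
qed

lemma borel_measurable_log_LR [measurable (raw)]:
  assumes [measurable]: "f \<in> borel_measurable M"
  shows "(\<lambda>x. log_LR n mu S z (f x)) \<in> borel_measurable M"
proof -
  have [measurable]: "(*v) (matrix_inv S) \<in> borel_measurable borel"
    by (intro borel_measurable_continuous_onI linear_continuous_on matrix_vector_mul_bounded_linear)
  show ?thesis unfolding log_LR_def by measurable
qed

lemma gmeas_replaced_mean:
  fixes S :: "real^'d^'d"
  assumes n: "n \<ge> 2" and B: "\<And>x y. x \<bullet> (matrix_inv S *v y) = (B *v x) \<bullet> (B *v y)"
  shows "gmeas B ((real n - 1) / (real n)\<^sup>2) ((1 / real n) *\<^sub>R (z + (real n - 1) *\<^sub>R mu))
    = density (gmeas B (1 / real n) mu) (\<lambda>w. ennreal (exp (log_LR n mu S z (w - mu))))"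
  unfolding gmeas_def gdens_replaced_mean[OF n B]
  by (subst density_density_eq) (auto simp: ennreal_mult)

text \<open>The kernel in \<open>H1_data\<close> is defined for every natural number \<open>J\<close>. For \<open>J\<close> outside \<open>{1..n}\<close> the
  update leaves the product space and is not measurable, hence the arbitrary \<open>f\<close>.\<close>
lemma distr_in_subprob_algebra:
  assumes "prob_space M"
  shows "distr M M f \<in> space (subprob_algebra M)"
proof -
  interpret prob_space M by fact
  \<comment> \<open>If the image set function of a non-measurable \<open>f\<close> is not a measure,
    \<open>emeasure\<close> defaults to zero, so the bound by one holds in every case.\<close>
  have "emeasure (distr M M f) (space M) \<le> 1"
    unfolding distr_def emeasure_measure_of_conv by (auto intro: emeasure_le_1)
  then have "subprob_space (distr M M f)"
    using not_empty by (intro subprob_spaceI) auto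
  then show ?thesis by (simp add: space_subprob_algebra)
qed

section \<open>Laws of the cumulative means under the two hypotheses\<close>

context
  fixes T n tau :: nat and mu z :: "real^'d" and S B :: "real^'d^'d"
  assumes T: "T \<ge> 1" and n: "n \<ge> 2" and tau: "tau \<in> {1..T}"
    and B: "\<And>x y. x \<bullet> (matrix_inv S *v y) = (B *v x) \<bullet> (B *v y)" and detB: "(det B)\<^sup>2 * det S = 1"
begin

lemma det_factor_nonzero: "det B \<noteq> 0"
  using detB by auto

lemma H0_data_eq: "H0_data T n mu S = PiM ({1..T} \<times> {1..n}) (\<lambda>_. gmeas B 1 mu)"
  by (simp add: H0_data_def gauss_measure_eq_gmeas[OF B detB])

lemma prob_space_H0_data: "prob_space (H0_data T n mu S)"
  unfolding H0_data_eq by (intro prob_space_PiM prob_space_gmeas det_factor_nonzero) simp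

text \<open>The row statistics \<open>g t\<close> are left arbitrary so that the plain batch means
  and those with a replaced point are both covered.\<close>

lemma distr_row_means:
  assumes [measurable]: "\<And>t. t \<in> {1..T} \<Longrightarrow> g t \<in> PiM {1..n} (\<lambda>_. gmeas B 1 mu) \<rightarrow>\<^sub>M lborel"
  shows "distr (H0_data T n mu S) (obs_space T) (\<lambda>X. running_means T (\<lambda>t\<in>{1..T}. g t (\<lambda>k\<in>{1..n}. X (t, k))))
    = distr (PiM {1..T} (\<lambda>t. distr (PiM {1..n} (\<lambda>_. gmeas B 1 mu)) lborel (g t))) (obs_space T) (running_means T)"
proof -
  let ?W = "\<lambda>X. \<lambda>t\<in>{1..T}. g t (\<lambda>k\<in>{1..n}. X (t, k))"
  have W: "?W \<in> H0_data T n mu S \<rightarrow>\<^sub>M obs_space T"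
    unfolding H0_data_eq obs_space_def
  proof (rule measurable_restrict)
    fix t assume t: "t \<in> {1..T}"
    show "(\<lambda>X. g t (\<lambda>k\<in>{1..n}. X (t, k))) \<in> PiM ({1..T} \<times> {1..n}) (\<lambda>_. gmeas B 1 mu) \<rightarrow>\<^sub>M lborel"
      using t by (intro measurable_compose[OF _ assms] measurable_restrict measurable_component_singleton) auto
  qed
  have L: "running_means T \<in> obs_space T \<rightarrow>\<^sub>M obs_space T"
    unfolding obs_space_def by (rule measurable_running_means)
  have "distr (H0_data T n mu S) (obs_space T) (\<lambda>X. running_means T (?W X))
    = distr (distr (H0_data T n mu S) (obs_space T) ?W) (obs_space T) (running_means T)"
    by (subst distr_distr[OF L W]) (simp add: o_def)
  also have "distr (H0_data T n mu S) (obs_space T) ?W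
    = PiM {1..T} (\<lambda>t. distr (PiM {1..n} (\<lambda>_. gmeas B 1 mu)) lborel (g t))"
    unfolding H0_data_eq obs_space_def
    using T n by (intro distr_PiM_rows prob_space_gmeas det_factor_nonzero assms) auto
  finally show ?thesis .
qed

lemma distr_cum_means_H0:
  "distr (H0_data T n mu S) (obs_space T) (cum_means T n)
    = distr (PiM {1..T} (\<lambda>_. gmeas B (1 / n) mu)) (obs_space T) (running_means T)"
proof -
  define g :: "nat \<Rightarrow> (nat \<Rightarrow> real^'d) \<Rightarrow> real^'d" where "g t r = (1 / real n) *\<^sub>R (\<Sum>k=1..n. r k)" for t r
  have g: "g t \<in> PiM {1..n} (\<lambda>_. gmeas B 1 mu) \<rightarrow>\<^sub>M lborel" for t
    unfolding g_def by simp
  have "cum_means T n = (\<lambda>X. running_means T (\<lambda>t\<in>{1..T}. g t (\<lambda>k\<in>{1..n}. X (t, k))))"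
    unfolding cum_means_eq_running_means g_def by auto
  then have "distr (H0_data T n mu S) (obs_space T) (cum_means T n)
    = distr (PiM {1..T} (\<lambda>t. distr (PiM {1..n} (\<lambda>_. gmeas B 1 mu)) lborel (g t))) (obs_space T) (running_means T)"
    using distr_row_means[OF g] by simp
  moreover have "distr (PiM {1..n} (\<lambda>_. gmeas B 1 mu)) lborel (g t) = gmeas B (1 / n) mu" for t
    using distr_mean_gmeas[of "{1..n}" 1 B mu] n det_factor_nonzero unfolding g_def by simp
  ultimately show ?thesis by simp
qed

text \<open>The replacement is moved from the data into the statistic of row \<open>tau\<close>, so
  the argument still runs over independent null data. Only the factor for batch \<open>tau\<close>
  of the product law changes, and its density passes through \<open>running_means\<close> because
  that batch mean can be recovered from the image.\<close>

lemma distr_cum_means_fun_upd: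
  assumes J: "J \<in> {1..n}"
  shows "distr (H0_data T n mu S) (obs_space T) (\<lambda>X. cum_means T n (X((tau, J) := z)))
    = density (distr (H0_data T n mu S) (obs_space T) (cum_means T n))
        (\<lambda>y. ennreal (exp (log_LR n mu S z (N_tau tau mu y))))"
proof -
  define g :: "nat \<Rightarrow> (nat \<Rightarrow> real^'d) \<Rightarrow> real^'d" where
    "g t r = (1 / real n) *\<^sub>R (\<Sum>k=1..n. if t = tau \<and> k = J then z else r k)" for t r
  let ?R = "\<lambda>w. ennreal (exp (log_LR n mu S z (w - mu)))"
  let ?M = "gmeas B (1 / n) mu"
  let ?f = "\<lambda>t. if t = tau then ?R else (\<lambda>_. 1)"
  have R[measurable]: "?R \<in> borel_measurable borel"
    by measurable
  have g: "g t \<in> PiM {1..n} (\<lambda>_. gmeas B 1 mu) \<rightarrow>\<^sub>M lborel" for t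
    unfolding g_def by simp
  have "(\<Sum>k=1..n. (X((tau, J) := z)) (t, k)) = (\<Sum>k=1..n. if t = tau \<and> k = J then z else X (t, k))" for X t
    by (intro sum.cong) auto
  then have "(\<lambda>X. cum_means T n (X((tau, J) := z))) = (\<lambda>X. running_means T (\<lambda>t\<in>{1..T}. g t (\<lambda>k\<in>{1..n}. X (t, k))))"
    unfolding cum_means_eq_running_means g_def by (auto intro!: ext arg_cong[where f="running_means T"] sum.cong)
  then have "distr (H0_data T n mu S) (obs_space T) (\<lambda>X. cum_means T n (X((tau, J) := z)))
    = distr (PiM {1..T} (\<lambda>t. distr (PiM {1..n} (\<lambda>_. gmeas B 1 mu)) lborel (g t))) (obs_space T) (running_means T)"
    using distr_row_means[OF g] by simp
  also have "(\<lambda>t. distr (PiM {1..n} (\<lambda>_. gmeas B 1 mu)) lborel (g t)) = (\<lambda>t. density ?M (?f t))"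
  proof
    fix t
    show "distr (PiM {1..n} (\<lambda>_. gmeas B 1 mu)) lborel (g t) = density ?M (?f t)"
    proof (cases "t = tau")
      case True
      then show ?thesis
        using distr_mean_replaced_gmeas[of "{1..n}" J 1 B mu z] n J det_factor_nonzero gmeas_replaced_mean[OF n B]
        unfolding g_def by simp
    next
      case False
      then show ?thesis
        using distr_mean_gmeas[of "{1..n}" 1 B mu] n det_factor_nonzero unfolding g_def by (simp add: density_1)
    qed
  qed
  also have "PiM {1..T} (\<lambda>t. density ?M (?f t)) = density (PiM {1..T} (\<lambda>_. ?M)) (\<lambda>w. \<Prod>t=1..T. ?f t (w t))"
  proof (rule PiM_density)
    show "product_sigma_finite (\<lambda>_. ?M)"
      using n by (intro product_sigma_finite_prob prob_space_gmeas det_factor_nonzero) auto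
    have "prob_space (density ?M (?f t))" for t
    proof (cases "t = tau")
      case True
      \<comment> \<open>Reweighting by \<open>?R\<close> gives the normal law of the mean with a
        replaced point, hence total mass one.\<close>
      have "prob_space (density ?M ?R)"
        unfolding gmeas_replaced_mean[OF n B, symmetric] using n by (intro prob_space_gmeas det_factor_nonzero) auto
      then show ?thesis using True by simp
    next
      case False
      then show ?thesis using n prob_space_gmeas[OF _ det_factor_nonzero] by (simp add: density_1)
    qed
    then show "product_sigma_finite (\<lambda>t. density ?M (?f t))"
      by (rule product_sigma_finite_prob)
  qed auto
  also have "(\<lambda>w. \<Prod>t=1..T. ?f t (w t)) = (\<lambda>w. ?R (w tau))"
    using tau by (auto simp: if_distrib[of "\<lambda>f. f _"] fun_eq_iff prod.delta cong: if_cong)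
  \<comment> \<open>The density must be a function of the image point before it can be moved past
    \<open>distr\<close>, so \<open>w tau\<close> is expressed through the running means.\<close>
  also have "density (PiM {1..T} (\<lambda>_. ?M)) (\<lambda>w. ?R (w tau))
    = density (PiM {1..T} (\<lambda>_. ?M)) (\<lambda>w. ?R (batch_mean (running_means T w) tau))"
    by (simp only: batch_mean_running_means[OF tau])
  also have "distr \<dots> (obs_space T) (running_means T)
    = density (distr (PiM {1..T} (\<lambda>_. ?M)) (obs_space T) (running_means T)) (\<lambda>y. ?R (batch_mean y tau))"
  proof (rule density_distr[symmetric])
    have "(\<lambda>y. batch_mean y tau) \<in> obs_space T \<rightarrow>\<^sub>M borel"
      using tau unfolding obs_space_def by (intro measurable_batch_mean) auto
    then show "(\<lambda>y. ?R (batch_mean y tau)) \<in> borel_measurable (obs_space T)"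
      by (rule measurable_compose[OF _ R])
    show "running_means T \<in> PiM {1..T} (\<lambda>_. ?M) \<rightarrow>\<^sub>M obs_space T"
      using measurable_running_means[of T] unfolding obs_space_def
      by (simp cong: measurable_cong_sets sets_PiM_cong)
  qed
  finally show ?thesis by (simp only: distr_cum_means_H0 N_tau_eq_batch_mean)
qed

text \<open>The law under the alternative is a mixture over \<open>J\<close>, and each component
  gives the cumulative means the same law, so the mixture does too.\<close>

lemma distr_cum_means_H1:
  assumes cm: "cum_means T n \<in> H0_data T n mu S \<rightarrow>\<^sub>M obs_space T"
  shows "distr (H1_data T n tau mu S z) (obs_space T) (cum_means T n)
    = density (distr (H0_data T n mu S) (obs_space T) (cum_means T n))
        (\<lambda>y. ennreal (exp (log_LR n mu S z (N_tau tau mu y))))" (is "_ = ?D")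
proof (rule measure_eqI)
  let ?H0 = "H0_data T n mu S"
  let ?k = "\<lambda>J. distr ?H0 ?H0 (\<lambda>X. X((tau, J) := z))"
  have k: "?k \<in> measure_pmf (pmf_of_set {1..n}) \<rightarrow>\<^sub>M subprob_algebra ?H0"
    using distr_in_subprob_algebra[OF prob_space_H0_data] by simp
  have sets_H1: "sets (H1_data T n tau mu S z) = sets ?H0"
    unfolding H1_data_def by (rule sets_bind[where N="?H0"]) auto
  have cm1: "cum_means T n \<in> H1_data T n tau mu S z \<rightarrow>\<^sub>M obs_space T"
    using cm sets_H1 by (simp cong: measurable_cong_sets)
  fix A assume "A \<in> sets (distr (H1_data T n tau mu S z) (obs_space T) (cum_means T n))"
  then have A: "A \<in> sets (obs_space T)" by simp
  let ?A = "cum_means T n -` A \<inter> space ?H0"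
  have mA: "?A \<in> sets ?H0" using cm A by (rule measurable_sets)
  have "emeasure (distr (H1_data T n tau mu S z) (obs_space T) (cum_means T n)) A
     = emeasure (H1_data T n tau mu S z) ?A"
    using sets_eq_imp_space_eq[OF sets_H1] by (simp add: emeasure_distr[OF cm1 A])
  also have "\<dots> = (\<integral>\<^sup>+J. emeasure (?k J) ?A \<partial>measure_pmf (pmf_of_set {1..n}))"
    unfolding H1_data_def by (rule emeasure_bind[OF _ k mA]) simp
  also have "\<dots> = (\<integral>\<^sup>+J. emeasure ?D A \<partial>measure_pmf (pmf_of_set {1..n}))"
  \<comment> \<open>Only indices in the support \<open>{1..n}\<close> are compared; for them the
    update is measurable and stays in the product space.\<close>
  proof (rule nn_integral_cong_AE)
    have "emeasure (?k J) ?A = emeasure ?D A" if J: "J \<in> {1..n}" for J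
    proof -
      have u: "(\<lambda>X. X((tau, J) := z)) \<in> ?H0 \<rightarrow>\<^sub>M ?H0"
        unfolding H0_data_eq using J tau by (intro measurable_fun_upd[where J="{1..T} \<times> {1..n}"]) auto
      have "emeasure (?k J) ?A = emeasure ?H0 ((\<lambda>X. cum_means T n (X((tau, J) := z))) -` A \<inter> space ?H0)"
        unfolding emeasure_distr[OF u mA] using measurable_space[OF u]
        by (auto intro!: arg_cong[where f="emeasure _"])
      also have "\<dots> = emeasure (distr ?H0 (obs_space T) (\<lambda>X. cum_means T n (X((tau, J) := z)))) A"
        using A by (subst emeasure_distr[OF measurable_compose[OF u cm]]) auto
      finally show ?thesis unfolding distr_cum_means_fun_upd[OF J] .
    qed
    then show "AE J in measure_pmf (pmf_of_set {1..n}). emeasure (?k J) ?A = emeasure ?D A"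
      using n by (auto simp: AE_measure_pmf_iff)
  qed
  also have "\<dots> = emeasure ?D A" by simp
  finally show "emeasure (distr (H1_data T n tau mu S z) (obs_space T) (cum_means T n)) A = emeasure ?D A" .
qed simp

text \<open>Under the law with density \<open>f0\<close> the zero set of \<open>f0\<close> is null.
  That law is the image under \<open>running_means\<close> of a law with strictly positive density,
  so the preimage of the zero set is Lebesgue null, and \<open>AE_batch_mean\<close> carries this
  back to the cumulative means.\<close>

lemma density_H0_nonzero:
  assumes f0: "distributed (H0_data T n mu S) (obs_space T) (cum_means T n) f0"
  shows "AE y in obs_space T. f0 y \<noteq> 0"
proof -
  let ?M = "gmeas B (1 / n) mu"
  have f0m[measurable]: "f0 \<in> borel_measurable (PiM {1..T} (\<lambda>_. lborel))"
    using distributed_borel_measurable[OF f0] by (simp add: obs_space_def)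
  have "AE y in density (obs_space T) f0. f0 y \<noteq> 0"
    by (subst AE_density) (auto simp: distributed_borel_measurable[OF f0])
  also have "density (obs_space T) f0 = distr (PiM {1..T} (\<lambda>_. ?M)) (obs_space T) (running_means T)"
    using distributed_distr_eq_density[OF f0] distr_cum_means_H0 by simp
  also have "PiM {1..T} (\<lambda>_. ?M) = density (PiM {1..T} (\<lambda>_. lborel)) (\<lambda>x. \<Prod>t=1..T. gdens B (1 / n) mu (x t))"
  proof -
    have p: "product_sigma_finite (\<lambda>_::nat. ?M)"
      using n by (intro product_sigma_finite_prob prob_space_gmeas det_factor_nonzero) auto
    have "product_sigma_finite (\<lambda>_::nat. lborel :: (real^'d) measure)" ..
    from PiM_density[OF _ this p[unfolded gmeas_def], of "{1..T}"] show ?thesis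
      using n by (simp add: gmeas_def prod_ennreal)
  qed
  finally have "AE w in density (PiM {1..T} (\<lambda>_. lborel)) (\<lambda>x. \<Prod>t=1..T. gdens B (1 / n) mu (x t)). f0 (running_means T w) \<noteq> 0"
    by (subst (asm) AE_distr_iff) (auto simp: obs_space_def simp del: One_nat_def)
  then have "AE w in PiM {1..T} (\<lambda>_. lborel). f0 (running_means T w) \<noteq> 0"
    using n det_factor_nonzero by (subst (asm) AE_density) (auto simp: gdens_pos prod_pos)
  then have "AE y in PiM {1..T} (\<lambda>_. lborel). f0 (running_means T (\<lambda>t\<in>{1..T}. batch_mean y t)) \<noteq> 0"
    by (rule AE_batch_mean[rotated]) measurable
  moreover have "AE y in PiM {1..T} (\<lambda>_. lborel). running_means T (\<lambda>t\<in>{1..T}. batch_mean y t) = (y :: nat \<Rightarrow> real^'d)"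
    by (rule AE_I2) (simp add: space_PiM PiE_def running_means_batch_mean del: One_nat_def)
  ultimately show ?thesis unfolding obs_space_def by eventually_elim simp
qed

end

theorem theorem3p1:
  fixes T n tau :: nat and mu z :: "real^'d" and S :: "real^'d^'d"
    and f0 f1 :: "(nat \<Rightarrow> real^'d) \<Rightarrow> ennreal"
  assumes "T \<ge> 1" and "n \<ge> 2" and "tau \<in> {1..T}" and "pos_def_mat S"
    and "distributed (H0_data T n mu S) (obs_space T) (cum_means T n) f0"
    and "distributed (H1_data T n tau mu S z) (obs_space T) (cum_means T n) f1"
  shows "AE y in obs_space T.
           ln (enn2real (f1 y) / enn2real (f0 y)) =
             - (real CARD('d) / 2) * ln ((real n - 1) / real n)
             - real n / (2 * (real n - 1)) * (N_tau tau mu y \<bullet> (matrix_inv S *v N_tau tau mu y))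
             + real n / (real n - 1) * (N_tau tau mu y \<bullet> (matrix_inv S *v (z - mu)))
             - ((z - mu) \<bullet> (matrix_inv S *v (z - mu))) / (2 * (real n - 1))"
proof -
  obtain B where B: "\<And>x y. x \<bullet> (matrix_inv S *v y) = (B *v x) \<bullet> (B *v y)" and detB: "(det B)\<^sup>2 * det S = 1"
    using pos_def_mat_inv_factor[OF assms(4)] by blast
  note setting = assms(1-3) B detB
  let ?r = "\<lambda>y. ennreal (exp (log_LR n mu S z (N_tau tau mu y)))"
  have m0[measurable]: "f0 \<in> borel_measurable (obs_space T)" and m1[measurable]: "f1 \<in> borel_measurable (obs_space T)"
    using assms(5,6) by (auto intro: distributed_borel_measurable)
  have mr[measurable]: "?r \<in> borel_measurable (obs_space T)"
  proof -
    have "(\<lambda>y. batch_mean y tau) \<in> obs_space T \<rightarrow>\<^sub>M borel"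
      using assms(3) unfolding obs_space_def by (intro measurable_batch_mean) auto
    then show ?thesis
      unfolding N_tau_eq_batch_mean by measurable
  qed
  have "density (obs_space T) f1 = density (density (obs_space T) f0) ?r"
    using distr_cum_means_H1[OF setting distributed_measurable[OF assms(5)], of z]
    unfolding distributed_distr_eq_density[OF assms(5)] distributed_distr_eq_density[OF assms(6)] .
  also have "\<dots> = density (obs_space T) (\<lambda>y. f0 y * ?r y)"
    using m0 mr by (rule density_density_eq)
  finally have eq: "density (obs_space T) f1 = density (obs_space T) (\<lambda>y. f0 y * ?r y)" .
  interpret product_sigma_finite "\<lambda>_::nat. lborel :: (real^'d) measure" ..
  interpret O: sigma_finite_measure "obs_space T :: (nat \<Rightarrow> real^'d) measure"
    unfolding obs_space_def by (rule sigma_finite) simp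
  \<comment> \<open>Densities with respect to a sigma-finite measure are unique up to null sets, so
    the identity holds for whichever versions \<open>f0\<close> and \<open>f1\<close> are
    given.\<close>
  have "AE y in obs_space T. f1 y = f0 y * ?r y"
    using eq by (intro O.density_unique m1 borel_measurable_times_ennreal m0 mr)
  moreover have "AE y in obs_space T. f0 y \<noteq> 0"
    by (rule density_H0_nonzero[OF setting assms(5)])
  \<comment> \<open>\<open>enn2real\<close> sends infinity to zero, so a nonzero denominator
    requires \<open>f0\<close> to be finite as well as nonzero. Finiteness holds almost everywhere
    since \<open>f0\<close> integrates to one.\<close>
  moreover have "AE y in obs_space T. f0 y \<noteq> \<infinity>"
  proof (rule nn_integral_PInf_AE)
    interpret D: prob_space "distr (H0_data T n mu S) (obs_space T) (cum_means T n)"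
      using prob_space_H0_data[OF setting] distributed_measurable[OF assms(5)] by (rule prob_space.prob_space_distr)
    have "(\<integral>\<^sup>+y. f0 y \<partial>obs_space T) = emeasure (density (obs_space T) f0) (space (obs_space T))"
      by (subst emeasure_density) (auto intro!: nn_integral_cong)
    also have "\<dots> = 1"
      using D.emeasure_space_1 by (simp add: distributed_distr_eq_density[OF assms(5)])
    finally show "(\<integral>\<^sup>+y. f0 y \<partial>obs_space T) \<noteq> \<infinity>" by simp
  qed simp
  ultimately show ?thesis
  proof eventually_elim
    case (elim y)
    have "enn2real (f0 y) \<noteq> 0" using elim by (auto simp: enn2real_eq_0_iff)
    moreover have "enn2real (f1 y) = enn2real (f0 y) * exp (log_LR n mu S z (N_tau tau mu y))"
      using elim by (simp add: enn2real_mult)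
    ultimately have "ln (enn2real (f1 y) / enn2real (f0 y)) = log_LR n mu S z (N_tau tau mu y)" by simp
    then show ?case unfolding log_LR_def .
  qed
qed

end
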